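(* Let $\tau\in\mathbb H$, $\boldsymbol x\in\mathbb R^n$, and let $M=(\boldsymbol{m_1},\dots,\boldsymbol{m_r})$ with $\boldsymbol{m_1},\dots,\boldsymbol{m_r}\in\mathbb R^n$ linearly independent. Set $$R(\boldsymbol x):=\sum_{\sigma\in S_r}\sum_{\ell=0}^r\frac{E_{Q,M_{\sigma[\ell+1,r]\perp\sigma[1,\ell]}}(\boldsymbol 0)}{(r-\ell)!}\int_\tau^{\tau+i\infty}\frac{B(\boldsymbol{v_{1,\sigma}},\boldsymbol x)e^{\pi iB(\boldsymbol{v_{1,\sigma}},\boldsymbol x)^2(w_1-\tau)}}{\sqrt{i(w_1-\tau)}}\int_\tau^{w_1}\frac{B(\boldsymbol{v_{2,\sigma}},\boldsymbol x)e^{\pi iB(\boldsymbol{v_{2,\sigma}},\boldsymbol x)^2(w_2-\tau)}}{\sqrt{i(w_2-\tau)}}\cdots\int_\tau^{w_{\ell-1}}\frac{B(\boldsymbol{v_{\ell,\sigma}},\boldsymbol x)e^{\pi iB(\boldsymbol{v_{\ell,\sigma}},\boldsymbol x)^2(w_\ell-\tau)}}{\sqrt{i(w_\ell-\tau)}}\,dw_\ell\cdots dw_2\,dw_1 ,$$ where for $\ell=0$ the iterated integral is $1$. If all components of $B(M,\boldsymbol x)$ are non-zero, then $$\operatorname{sgn}(B(M,\boldsymbol x))=R(\boldsymbol x).$$ In case some components of $B(M,\boldsymbol x)$ are zero, one has more generally $$\sum_{S\subseteq\{1,\dots,r\}}E_{Q,M_S}(\boldsymbol 0)\,\delta_{B(M_S,\boldsymbol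 x)=\boldsymbol 0}\,\operatorname{sgn}\left(B(M_{\{1,\dots,r\}\setminus S},\boldsymbol x)\right)=R(\boldsymbol x).$$
   Context: $B(\boldsymbol x,\boldsymbol y)=\boldsymbol x^TA\boldsymbol y$ with $A\in\mathbb Z^{n\times n}$ symmetric positive definite, $Q(\boldsymbol x)=\frac12B(\boldsymbol x,\boldsymbol x)$. $B(M,\boldsymbol x)$ is the vector with components $B(\boldsymbol{m_j},\boldsymbol x)$, $\operatorname{sgn}(B(M,\boldsymbol x)):=\prod_{j}\operatorname{sgn}(B(\boldsymbol{m_j},\boldsymbol x))$, $\operatorname{sgn}(0):=0$, empty product $=1$. $\delta_{\mathcal S}$ is $1$ if statement $\mathcal S$ holds and $0$ otherwise (for $S=\emptyset$ the condition is vacuously true). The generalized error function is $$E_{Q,M}(\boldsymbol x):=\det(A)^{\frac12}\int_{\mathbb R^n}\operatorname{sgn}(B(M,\boldsymbol y))e^{-2\pi Q(\boldsymbol y-\boldsymbol x)}d^n\boldsymbol y,\qquad E_{Q,\emptyset}=1 .$$ For $S\subseteq\{1,\dots,r\}$, $M_S$ is the submatrix of columns indexed by $S$. $\boldsymbol{m_{k\perp S}}$ is the orthogonal projection (with respect to $B$) of $\boldsymbol{m_k}$ to the orthogonal complement of the span of $M_S$, and $M_{T\perp S}$ is the matrix with columns $\boldsymbol{m_{k\perp S}}$, $k\in T$. For $\sigma\in S_r$, $\sigma[a,b]:=\{\sigma(a),\dots,\sigma(b)\}$ (empty if $a>b$), and $(\boldsymbol{v_{1,\sigma}},\dots,\boldsymbol{v_{r,\sigma}})$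 is obtained by applying the orthonormal Gram–Schmidt process (with respect to $B$) to $(\boldsymbol{m_{\sigma(1)}},\dots,\boldsymbol{m_{\sigma(r)}})$. Square roots are principal values (argument of the radicand in $(-\pi,\pi]$); all integrals are taken along the vertical line going up from $\tau$. *)

theory Defs
  imports "HOL-Complex_Analysis.Complex_Analysis" "HOL-Combinatorics.Permutations"
begin

definition pos_def_matrix :: "real^'n^'n \<Rightarrow> bool" where
  "pos_def_matrix A \<longleftrightarrow> (\<forall>x. x \<noteq> 0 \<longrightarrow> 0 < x \<bullet> (A *v x))"

definition bform :: "real^'n^'n \<Rightarrow> real^'n \<Rightarrow> real^'n \<Rightarrow> real" where
  "bform A x y = x \<bullet> (A *v y)"

definition qform :: "real^'n^'n \<Rightarrow> real^'n \<Rightarrow> real" where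
  "qform A x = 1/2 * bform A x x"

text \<open>Matrices \<open>M\<close> are given by their columns, as a family \<open>m\<close> restricted to a finite index
  set \<open>I\<close>; so \<open>M\<^sub>S\<close> is the same family \<open>m\<close> with index set \<open>S\<close>. The order of the columns is
  irrelevant for the following two functions.\<close>

definition sgn_B :: "real^'n^'n \<Rightarrow> (nat \<Rightarrow> real^'n) \<Rightarrow> nat set \<Rightarrow> real^'n \<Rightarrow> real" where
  "sgn_B A m I x = (\<Prod>j\<in>I. sgn (bform A (m j) x))"

definition gen_erf :: "real^'n^'n \<Rightarrow> (nat \<Rightarrow> real^'n) \<Rightarrow> nat set \<Rightarrow> real^'n \<Rightarrow> real" where
  "gen_erf A m I x =
     (if I = {} then 1
      else sqrt (det A) * (LINT y|lborel. sgn_B A m I y * exp (- 2 * pi * qform A (y - x))))"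

definition proj_perp :: "real^'n^'n \<Rightarrow> (nat \<Rightarrow> real^'n) \<Rightarrow> nat set \<Rightarrow> nat \<Rightarrow> real^'n" where
  "proj_perp A m S k =
     (THE p. m k - p \<in> span (m ` S) \<and> (\<forall>u \<in> span (m ` S). bform A u p = 0))"

text \<open>\<open>proj_perp A m S k\<close> is \<open>m\<^bsub>k\<bottom>S\<^esub>\<close>; \<open>M\<^bsub>T\<bottom>S\<^esub>\<close> is the family \<open>proj_perp A m S\<close>
  with index set \<open>T\<close>.\<close>

text \<open>Orthonormal Gram--Schmidt process with respect to \<open>B\<close> for a sequence
  \<open>u 1, u 2, \<dots>\<close> (indices start at 1).\<close>

fun gram_schmidt_B :: "real^'n^'n \<Rightarrow> (nat \<Rightarrow> real^'n) \<Rightarrow> nat \<Rightarrow> real^'n" where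
  "gram_schmidt_B A u k =
     (let w = u k - (\<Sum>i\<in>{1..<k}. bform A (u k) (gram_schmidt_B A u i) *\<^sub>R gram_schmidt_B A u i)
      in w /\<^sub>R sqrt (bform A w w))"

declare gram_schmidt_B.simps [simp del]

definition kern :: "complex \<Rightarrow> real \<Rightarrow> complex \<Rightarrow> complex" where
  "kern \<tau> b w =
     of_real b * exp (of_real pi * \<i> * (of_real b)^2 * (w - \<tau>)) / csqrt (\<i> * (w - \<tau>))"

text \<open>The inner iterated integrals, where \<open>w\<close> is the upper limit of the first one and the
  list contains the values \<open>b\<^sub>j\<close> in the order of integration from outside to inside. For \<open>w\<close>
  vertically above \<open>\<tau>\<close>, \<open>linepath \<tau> w\<close> runs along the vertical line.\<close>

primrec inner_iter_int :: "complex \<Rightarrow> real list \<Rightarrow> complex \<Rightarrow> complex" where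
  "inner_iter_int \<tau> [] w = 1"
| "inner_iter_int \<tau> (b # bs) w =
     contour_integral (linepath \<tau> w) (\<lambda>w'. kern \<tau> b w' * inner_iter_int \<tau> bs w')"

text \<open>Integral from \<open>\<tau>\<close> to \<open>\<tau> + \<i>\<infinity>\<close>, parametrised by \<open>w = \<tau> + \<i>t\<close>, \<open>dw = \<i> dt\<close>.\<close>

definition upward_integral :: "complex \<Rightarrow> (complex \<Rightarrow> complex) \<Rightarrow> complex" where
  "upward_integral \<tau> f = integral {0..} (\<lambda>t::real. f (\<tau> + \<i> * of_real t) * \<i>)"

primrec iter_int :: "complex \<Rightarrow> real list \<Rightarrow> complex" where
  "iter_int \<tau> [] = 1"
| "iter_int \<tau> (b # bs) = upward_integral \<tau> (\<lambda>w. kern \<tau> b w * inner_iter_int \<tau> bs w)"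

definition R_fun ::
  "real^'n^'n \<Rightarrow> nat \<Rightarrow> (nat \<Rightarrow> real^'n) \<Rightarrow> complex \<Rightarrow> real^'n \<Rightarrow> complex" where
  "R_fun A r m \<tau> x =
     (\<Sum>\<sigma> | \<sigma> permutes {1..r}. \<Sum>l = 0..r.
        of_real (gen_erf A (proj_perp A m (\<sigma> ` {1..l})) (\<sigma> ` {l+1..r}) 0 / fact (r - l)) *
        iter_int \<tau> (map (\<lambda>j. bform A (gram_schmidt_B A (\<lambda>i. m (\<sigma> i)) j) x) [1..<Suc l]))"

end

theory Submission
  imports Defs "HOL-Probability.Distributions"
begin

text \<open>The generalized error function is a Gaussian mean: if \<open>y\<close> has the density
\<open>sqrt (det A) * exp (- 2 * pi * qform A y)\<close>, then \<open>gen_erf A m I x\<close> is the mean of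
\<open>sgn_B A m I (y + x)\<close>. The proof evaluates the limit of \<open>gen_erf A m I (s *\<^sub>R x)\<close> for
\<open>s \<rightarrow> \<infinity>\<close> in two ways.

On the one hand, the signs with \<open>B(m\<^sub>j, x) \<noteq> 0\<close> freeze and the others do not depend on \<open>s\<close>
(\<open>gen_erf_limit\<close>). With \<open>Z\<close> the set of \<open>j\<close> with \<open>B(m\<^sub>j, x) = 0\<close>, the limit is the product of
\<open>gen_erf A m Z 0\<close> and the signs outside \<open>Z\<close>. This is the left-hand side, where only the summand
\<open>S = Z\<close> survives.

On the other hand, for a generic fixed \<open>y\<close> the product of signs at \<open>y + s *\<^sub>R x\<close> is a step function of
\<open>s\<close>, and its increment is the sum of its jumps (\<open>sgn_prod_jumps\<close>). The \<open>k\<close>-th sign jumps when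
\<open>y + s *\<^sub>R x\<close> becomes orthogonal to \<open>m\<^sub>k\<close>; the time of the jump is determined by the component of \<open>y\<close>
along \<open>m\<^sub>k\<close>, which is Gaussian and independent of the orthogonal component (\<open>integral_resample\<close>), and at
that time the other signs only see the projections of the other \<open>m\<^sub>i\<close>. Taking means gives, with
\<open>c\<^sub>k\<close> the product of \<open>x\<close> with the normalized \<open>m\<^sub>k\<close>, the recursion (\<open>gen_erf_recursion\<close>)
\<open>E\<^sub>M(s x) = E\<^sub>M(0) + \<Sum>\<^sub>k \<integral>\<^sub>0\<^sup>s 2 c\<^sub>k exp(-\<pi> c\<^sub>k\<^sup>2 u\<^sup>2) E\<^sub>N(u x) du\<close>,
where \<open>N\<close> consists of the other columns projected to the complement of \<open>m\<^sub>k\<close>.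

Iterating it yields a sum over sequences of distinct indices (\<open>gen_erf_expansion\<close>). Projections
compose (\<open>proj_perp_insert\<close>), and the normalized successive projections are the Gram--Schmidt vectors
(\<open>gram_schmidt_B_eq\<close>). The substitution \<open>u = sqrt t\<close> turns the real iterated integrals into those
along the vertical line (\<open>iter_int_eq_limit\<close>). Each sequence of length \<open>l\<close> is the beginning of
\<open>(r - l)!\<close> permutations, which accounts for the factorial in the sum over permutations
(\<open>sum_permutations_eq_distinct_lists\<close>).\<close>

section \<open>Shears and Gaussian integrals\<close>

lemma nn_integral_lborel_translate:
  fixes a :: "'a::euclidean_space"
  assumes [measurable]: "f \<in> borel_measurable borel"
  shows "(\<integral>\<^sup>+x. f (a + x) \<partial>lborel) = (\<integral>\<^sup>+x. f x \<partial>lborel)"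
  by (subst (2) lborel_distr_plus[of a, symmetric]) (simp add: nn_integral_distr)

text \<open>A shear moves every point of a line parallel to \<open>e\<close> by the same amount, so it should preserve
volume. To avoid choosing coordinates adapted to \<open>e\<close>, the integral is averaged over an auxiliary
Gaussian variable \<open>t\<close> that translates along \<open>e\<close>; the displacement \<open>\<phi> y\<close> can then be absorbed into
\<open>t\<close>, and only translation invariance and Tonelli are needed.\<close>
lemma nn_integral_lborel_shear:
  fixes e :: "'a::euclidean_space" and \<phi> :: "'a \<Rightarrow> real"
  assumes [measurable]: "f \<in> borel_measurable borel" "\<phi> \<in> borel_measurable borel"
    and inv: "\<And>y t. \<phi> (t *\<^sub>R e + y) = \<phi> y"
  shows "(\<integral>\<^sup>+y. f (y + \<phi> y *\<^sub>R e) \<partial>lborel) = (\<integral>\<^sup>+y. f y \<partial>lborel)"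
proof -
  define \<rho> where "\<rho> t = ennreal (std_normal_density t)" for t
  have [measurable]: "\<rho> \<in> borel_measurable borel" unfolding \<rho>_def by measurable
  have \<rho>1: "(\<integral>\<^sup>+t. \<rho> t \<partial>lborel) = 1"
    unfolding \<rho>_def by (subst nn_integral_eq_integral) auto
  have \<rho>_shift: "(\<integral>\<^sup>+t. \<rho> (a + t) \<partial>lborel) = 1" for a
    using nn_integral_lborel_translate[of \<rho> a] \<rho>1 by simp
  have "(\<integral>\<^sup>+y. f (y + \<phi> y *\<^sub>R e) \<partial>lborel)
      = (\<integral>\<^sup>+t. \<rho> t * (\<integral>\<^sup>+y. f (y + \<phi> y *\<^sub>R e) \<partial>lborel) \<partial>lborel)"
    by (simp add: nn_integral_multc \<rho>1)
  also have "\<dots> = (\<integral>\<^sup>+t. \<rho> t * (\<integral>\<^sup>+y. f ((t *\<^sub>R e + y) + \<phi> (t *\<^sub>R e + y) *\<^sub>R e) \<partial>lborel) \<partial>lborel)"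
    by (intro nn_integral_cong arg_cong2[where f="(*)"] refl
          nn_integral_lborel_translate[where f="\<lambda>y. f (y + \<phi> y *\<^sub>R e)", symmetric]) measurable
  also have "\<dots> = (\<integral>\<^sup>+t. (\<integral>\<^sup>+y. \<rho> t * f ((\<phi> y + t) *\<^sub>R e + y) \<partial>lborel) \<partial>lborel)"
    by (intro nn_integral_cong, subst inv, subst nn_integral_cmult) (auto simp: algebra_simps)
  also have "\<dots> = (\<integral>\<^sup>+y. (\<integral>\<^sup>+t. \<rho> t * f ((\<phi> y + t) *\<^sub>R e + y) \<partial>lborel) \<partial>lborel)"
    by (rule lborel_pair.Fubini') measurable
  also have "\<dots> = (\<integral>\<^sup>+y. (\<integral>\<^sup>+t. \<rho> (- \<phi> y + t) * f (t *\<^sub>R e + y) \<partial>lborel) \<partial>lborel)"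
  proof (rule nn_integral_cong)
    fix y
    show "(\<integral>\<^sup>+t. \<rho> t * f ((\<phi> y + t) *\<^sub>R e + y) \<partial>lborel)
        = (\<integral>\<^sup>+t. \<rho> (- \<phi> y + t) * f (t *\<^sub>R e + y) \<partial>lborel)"
      using nn_integral_lborel_translate[where f="\<lambda>t. \<rho> t * f ((\<phi> y + t) *\<^sub>R e + y)" and a="- \<phi> y"]
      by simp
  qed
  also have "\<dots> = (\<integral>\<^sup>+t. (\<integral>\<^sup>+y. \<rho> (- \<phi> (t *\<^sub>R e + y) + t) * f (t *\<^sub>R e + y) \<partial>lborel) \<partial>lborel)"
    by (subst inv, rule lborel_pair.Fubini') measurable
  also have "\<dots> = (\<integral>\<^sup>+t. (\<integral>\<^sup>+y. \<rho> (- \<phi> y + t) * f y \<partial>lborel) \<partial>lborel)"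
    by (intro nn_integral_cong
          nn_integral_lborel_translate[where f="\<lambda>y. \<rho> (- \<phi> y + _) * f y"]) measurable
  also have "\<dots> = (\<integral>\<^sup>+y. (\<integral>\<^sup>+t. \<rho> (- \<phi> y + t) * f y \<partial>lborel) \<partial>lborel)"
    by (rule lborel_pair.Fubini') measurable
  also have "\<dots> = (\<integral>\<^sup>+y. f y \<partial>lborel)"
    by (simp add: nn_integral_multc \<rho>_shift del: uminus_add_conv_diff)
  finally show ?thesis .
qed

lemma nn_integral_gaussian_real:
  assumes "a > 0"
  shows "(\<integral>\<^sup>+t. ennreal (exp (- pi * (a * t\<^sup>2))) \<partial>lborel) = ennreal (1 / sqrt a)"
proof -
  define \<sigma> where "\<sigma> = 1 / sqrt (2 * pi * a)"
  have \<sigma>: "\<sigma> > 0" "\<sigma>\<^sup>2 = 1 / (2 * pi * a)"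
    using assms by (auto simp: \<sigma>_def field_simps real_sqrt_mult)
  have "exp (- pi * (a * t\<^sup>2)) = normal_density 0 \<sigma> t / sqrt a" for t
    using assms by (simp add: normal_density_def \<sigma>(2) real_sqrt_divide field_simps)
  then have "(\<integral>\<^sup>+t. ennreal (exp (- pi * (a * t\<^sup>2))) \<partial>lborel)
      = (\<integral>\<^sup>+t. ennreal (normal_density 0 \<sigma> t / sqrt a) \<partial>lborel)" by simp
  also have "\<dots> = ennreal (\<integral>t. normal_density 0 \<sigma> t / sqrt a \<partial>lborel)"
    using \<sigma> assms by (intro nn_integral_eq_integral) auto
  also have "\<dots> = ennreal (1 / sqrt a)" using \<sigma> by simp
  finally show ?thesis .
qed

lemma bform_symmetric: "transpose A = A \<Longrightarrow> bform A x y = bform A y x"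
  by (metis bform_def dot_lmul_matrix inner_commute transpose_matrix_vector)

lemma bform_linear:
  "bform A (x + y) z = bform A x z + bform A y z"
  "bform A (x - y) z = bform A x z - bform A y z"
  "bform A (c *\<^sub>R x) z = c * bform A x z"
  "bform A z (x + y) = bform A z x + bform A z y"
  "bform A z (x - y) = bform A z x - bform A z y"
  "bform A z (c *\<^sub>R x) = c * bform A z x"
  "bform A 0 z = 0" "bform A z 0 = 0"
  "bform A (- x) z = - bform A x z" "bform A z (- x) = - bform A z x"
  by (auto simp: bform_def inner_simps matrix_vector_right_distrib matrix_vector_mult_diff_distrib
      matrix_vector_mult_scaleR linear_neg[OF matrix_vector_mul_linear])

text \<open>The coordinates that the quadratic form still couples to others; their number is the induction
measure for the diagonalization below.\<close>
definition off_diagonal_rows :: "real^'n^'n \<Rightarrow> 'n set" where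
  "off_diagonal_rows A = {k. \<exists>j. j \<noteq> k \<and> A $ k $ j \<noteq> 0}"

lemma bform_axis_left: "bform A (axis i 1) x = (A *v x) $ i"
  by (simp add: bform_def inner_axis')

lemma bform_axis: "bform A (axis i 1) (axis j 1) = A $ i $ j"
  by (simp add: bform_axis_left matrix_vector_mul_component inner_axis)

lemma borel_measurable_bform [measurable]:
  fixes A :: "real^'n^'n"
  shows "bform A v \<in> borel_measurable borel" "(\<lambda>y. bform A y y) \<in> borel_measurable borel"
proof -
  have "continuous_on UNIV (\<lambda>y. A *v y)"
    by (intro linear_continuous_on) (simp add: linear_linear)
  then show "bform A v \<in> borel_measurable borel" "(\<lambda>y. bform A y y) \<in> borel_measurable borel"
    unfolding bform_def by (auto intro!: borel_measurable_continuous_onI continuous_intros)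
qed

lemma diagonal_gaussian_integral:
  fixes A :: "real^'n^'n"
  assumes diag: "off_diagonal_rows A = {}" and pos: "pos_def_matrix A"
  shows "0 < det A \<and>
    (\<integral>\<^sup>+y. ennreal (exp (- pi * bform A y y)) \<partial>lborel) = ennreal (1 / sqrt (det A))"
proof -
  have off: "A $ i $ j = 0" if "i \<noteq> j" for i j
    using diag that unfolding off_diagonal_rows_def by (metis (mono_tags, lifting) empty_Collect_eq)
  have d: "A $ i $ i > 0" for i
    using pos[unfolded pos_def_matrix_def, rule_format, of "axis i 1"]
    by (simp add: bform_axis[unfolded bform_def] axis_eq_0_iff)
  have det: "det A = (\<Prod>i\<in>UNIV. A $ i $ i)" by (rule det_diagonal) (use off in auto)
  have Av: "(A *v y) $ i = A $ i $ i * y $ i" for y i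
  proof -
    have "(\<Sum>j\<in>UNIV. A $ i $ j * y $ j) = (\<Sum>j\<in>UNIV. if j = i then A $ i $ i * y $ i else 0)"
      by (rule sum.cong) (auto simp: off)
    then show ?thesis by (simp add: matrix_vector_mult_def)
  qed
  have form: "bform A y y = (\<Sum>i\<in>UNIV. A $ i $ i * (y $ i)\<^sup>2)" for y
    by (simp add: bform_def inner_vec_def Av power2_eq_square algebra_simps)
  have Basis: "(Basis :: (real^'n) set) = range (\<lambda>i. axis i 1)"
    by (auto simp: Basis_vec_def)
  have inj: "inj (\<lambda>i. axis i 1 :: real^'n)" by (auto simp: inj_on_def axis_eq_axis)
  have sqrt_prod: "sqrt (prod g S) = (\<Prod>i\<in>S. sqrt (g i))" for g and S :: "'n set"
    by (induction S rule: infinite_finite_induct) (auto simp: real_sqrt_mult)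
  define f :: "real^'n \<Rightarrow> real \<Rightarrow> ennreal"
    where "f b t = ennreal (exp (- pi * (bform A b b * t\<^sup>2)))" for b t
  have "(\<integral>\<^sup>+y. ennreal (exp (- pi * bform A y y)) \<partial>lborel)
      = (\<integral>\<^sup>+y. (\<Prod>b\<in>Basis. f b (y \<bullet> b)) \<partial>lborel)"
    unfolding form by (intro nn_integral_cong)
      (simp add: f_def Basis prod.reindex[OF inj] o_def bform_axis prod_ennreal exp_sum
        sum_distrib_left inner_axis flip: sum_negf)
  also have "\<dots> = (\<Prod>b\<in>Basis. (\<integral>\<^sup>+t. f b t \<partial>lborel))"
    by (rule nn_integral_lborel_prod) (auto simp: f_def)
  also have "\<dots> = (\<Prod>i\<in>UNIV. ennreal (1 / sqrt (A $ i $ i)))"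
    by (simp add: f_def Basis prod.reindex[OF inj] bform_axis nn_integral_gaussian_real[OF d, simplified])
  also have "\<dots> = ennreal (1 / sqrt (det A))"
    using d sqrt_prod[of "\<lambda>i. A $ i $ i" UNIV] by (simp add: prod_ennreal det prod_dividef less_imp_le)
  finally show ?thesis using d by (simp add: det prod_pos)
qed


text \<open>Completing the square in the coordinate \<open>x $ k\<close>: the shear \<open>x \<mapsto> x + \<phi> x *\<^sub>R e\<close> along the axis
\<open>e\<close> of \<open>k\<close>, with \<open>\<phi> x = x $ k - B(e,x)/a\<close> and \<open>a = A $ k $ k\<close>, turns \<open>B(e,x)\<close> into
\<open>a * x $ k\<close>. It decouples \<open>x $ k\<close> from the other coordinates, leaves coordinates that were already
decoupled as they are, and has determinant 1. As \<open>\<phi>\<close> is constant along \<open>e\<close>, the Gaussian integral does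
not change either.\<close>
lemma complete_square:
  fixes A :: "real^'n^'n"
  assumes sym: "transpose A = A" and pos: "pos_def_matrix A" and k: "k \<in> off_diagonal_rows A"
  obtains A' where "transpose A' = A'" "pos_def_matrix A'" "det A' = det A"
    "off_diagonal_rows A' \<subset> off_diagonal_rows A"
    "(\<integral>\<^sup>+y. ennreal (exp (- pi * bform A' y y)) \<partial>lborel)
      = (\<integral>\<^sup>+y. ennreal (exp (- pi * bform A y y)) \<partial>lborel)"
proof -
  let ?e = "axis k 1 :: real^'n"
  define a where "a = A $ k $ k"
  have a: "a > 0"
    using pos[unfolded pos_def_matrix_def, rule_format, of ?e]
    by (simp add: a_def bform_axis[unfolded bform_def] axis_eq_0_iff)
  define c :: "real^'n" where "c = ?e - (1 / a) *\<^sub>R row k A"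
  define P :: "real^'n^'n" where
    "P = (\<chi> i. if i = k then row k (mat 1) + c else row i (mat 1))"
  define \<phi> where "\<phi> x = c \<bullet> x" for x
  have \<phi>: "\<phi> x = x $ k - bform A ?e x / a" for x
    by (simp add: \<phi>_def c_def inner_diff_left inner_axis' bform_axis_left
        matrix_vector_mul_component row_def)
  have row1: "row i (mat 1 :: real^'n^'n) = axis i 1" for i
    by (simp add: row_def mat_def axis_def vec_eq_iff)
  have P: "P *v x = x + \<phi> x *\<^sub>R ?e" for x
    by (simp add: vec_eq_iff P_def matrix_vector_mul_component row1 inner_add_left inner_axis'
        \<phi>_def) (simp add: axis_def)
  have "c \<in> span {row j (mat 1 :: real^'n^'n) | j. j \<noteq> k}"
  proof -
    have "c = (\<Sum>j\<in>UNIV. c $ j *\<^sub>R axis j 1)"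
      by (simp add: vec_eq_iff axis_def if_distrib sum.delta cong: if_cong)
    also have "\<dots> = (\<Sum>j\<in>UNIV - {k}. c $ j *\<^sub>R axis j 1)"
      using a by (intro sum.mono_neutral_right) (auto simp: c_def row_def a_def)
    also have "\<dots> \<in> span {row j (mat 1 :: real^'n^'n) | j. j \<noteq> k}"
      by (intro span_sum span_scale span_base)
        (auto simp: row1)
    finally show ?thesis .
  qed
  then have detP: "det P = 1"
    unfolding P_def by (subst det_row_span) (auto simp: span_vec_eq)
  define A' where "A' = transpose P ** A ** P"
  have bA': "bform A' x y = bform A (P *v x) (P *v y)" for x y
    unfolding bform_def A'_def
    by (metis dot_lmul_matrix matrix_vector_mul_assoc transpose_matrix_vector transpose_transpose)
  note B = bform_symmetric[OF sym]
  have eP: "bform A ?e (P *v y) = a * y $ k" for y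
    using a by (simp add: P bform_linear bform_axis \<phi> a_def[symmetric] field_simps)
  have Pe: "P *v ?e = ?e"
    using a by (simp add: P \<phi> bform_axis a_def[symmetric])
  show thesis
  proof (rule that[of A'])
    show "transpose A' = A'"
      by (simp add: A'_def matrix_transpose_mul sym matrix_mul_assoc)
    show "det A' = det A" by (simp add: A'_def det_mul detP)
    show "pos_def_matrix A'"
      unfolding pos_def_matrix_def
    proof (intro allI impI)
      fix x :: "real^'n" assume "x \<noteq> 0"
      have "P *v x \<noteq> 0"
      proof
        assume 0: "P *v x = 0"
        have "a * x $ k = 0" using eP[of x] unfolding 0 by (simp add: bform_linear)
        then have "x $ k = 0" using a by simp
        moreover have "x = - \<phi> x *\<^sub>R ?e" using 0 by (simp add: P add_eq_0_iff)
        ultimately have "\<phi> x = 0" by (auto simp: vec_eq_iff axis_def dest: spec[of _ k])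
        then show False using 0 \<open>x \<noteq> 0\<close> by (simp add: P)
      qed
      then show "0 < x \<bullet> (A' *v x)"
        using pos bA'[of x x] by (simp add: bform_def pos_def_matrix_def)
    qed
    have "off_diagonal_rows A' \<subseteq> off_diagonal_rows A - {k}"
    proof
      fix i assume "i \<in> off_diagonal_rows A'"
      then obtain j where j: "j \<noteq> i" "A' $ i $ j \<noteq> 0" by (auto simp: off_diagonal_rows_def)
      have ne: "bform A (P *v axis i 1) (P *v axis j 1) \<noteq> 0"
        using j(2) by (simp add: bA'[symmetric] bform_axis)
      have "i \<noteq> k"
      proof
        assume "i = k"
        then have "bform A (P *v axis i 1) (P *v axis j 1) = a * axis j 1 $ k"
          using Pe eP[of "axis j 1"] by simp
        then show False using ne j(1) \<open>i = k\<close> by (simp add: axis_def)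
      qed
      moreover have "i \<in> off_diagonal_rows A"
      proof (rule ccontr)
        assume "i \<notin> off_diagonal_rows A"
        then have z: "A $ i $ l = 0" if "l \<noteq> i" for l using that by (auto simp: off_diagonal_rows_def)
        then have zk: "A $ i $ k = 0" "A $ k $ i = 0" "A $ i $ j = 0"
          using \<open>i \<noteq> k\<close> j(1) B[of ?e "axis i 1"] by (auto simp: bform_axis)
        have "P *v axis i 1 = axis i 1"
          using zk \<open>i \<noteq> k\<close> by (simp add: P \<phi> bform_axis) (simp add: axis_def)
        then show False using ne zk by (simp add: P bform_linear bform_axis)
      qed
      ultimately show "i \<in> off_diagonal_rows A - {k}" by simp
    qed
    then show "off_diagonal_rows A' \<subset> off_diagonal_rows A" using k by blast
    show "(\<integral>\<^sup>+y. ennreal (exp (- pi * bform A' y y)) \<partial>lborel)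
      = (\<integral>\<^sup>+y. ennreal (exp (- pi * bform A y y)) \<partial>lborel)"
      unfolding bA' P
    proof (rule nn_integral_lborel_shear[where f="\<lambda>y. ennreal (exp (- pi * bform A y y))"])
      show "\<phi> \<in> borel_measurable borel" unfolding \<phi>_def by measurable
      show "\<phi> (t *\<^sub>R ?e + y) = \<phi> y" for t y
        using a by (simp add: \<phi> bform_linear bform_axis a_def[symmetric] field_simps)
    qed measurable
  qed
qed

text \<open>Completing squares reduces the integral to a diagonal form, where it is a product of
one-dimensional integrals; the determinant stays the same all along.\<close>
lemma gaussian_integral:
  fixes A :: "real^'n^'n"
  assumes "transpose A = A" "pos_def_matrix A"
  shows "0 < det A \<and>
    (\<integral>\<^sup>+y. ennreal (exp (- pi * bform A y y)) \<partial>lborel) = ennreal (1 / sqrt (det A))"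
  using assms
proof (induction "card (off_diagonal_rows A)" arbitrary: A rule: less_induct)
  case less
  show ?case
  proof (cases "off_diagonal_rows A = {}")
    case True
    then show ?thesis using diagonal_gaussian_integral less by blast
  next
    case False
    then obtain k where "k \<in> off_diagonal_rows A" by blast
    from complete_square[OF less(2,3) this] obtain A' where A': "transpose A' = A'"
      "pos_def_matrix A'" "det A' = det A" "off_diagonal_rows A' \<subset> off_diagonal_rows A"
      "(\<integral>\<^sup>+y. ennreal (exp (- pi * bform A' y y)) \<partial>lborel)
        = (\<integral>\<^sup>+y. ennreal (exp (- pi * bform A y y)) \<partial>lborel)" by this
    have "card (off_diagonal_rows A') < card (off_diagonal_rows A)"
      by (rule psubset_card_mono) (use A' in auto)
    from less(1)[OF this A'(1,2)] show ?thesis using A' by simp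
  qed
qed

section \<open>The Gaussian probability measure\<close>

text \<open>The generalized error function averages signs with respect to this probability measure. The
exponent is \<open>- 2 * pi * qform A y\<close>.\<close>
definition gauss :: "real^'n^'n \<Rightarrow> (real^'n) measure" where
  "gauss A = density lborel (\<lambda>y. ennreal (sqrt (det A) * exp (- pi * bform A y y)))"

definition gauss_real :: "real measure" where
  "gauss_real = density lborel (\<lambda>t. ennreal (exp (- pi * t\<^sup>2)))"

lemma sets_gauss [measurable_cong, simp]: "sets (gauss A) = sets borel" "space (gauss A) = UNIV"
  by (auto simp: gauss_def)

lemma sets_gauss_real [measurable_cong, simp]: "sets gauss_real = sets borel" "space gauss_real = UNIV"
  by (auto simp: gauss_real_def)

lemma prob_space_gauss_real: "prob_space gauss_real"
  using nn_integral_gaussian_real[of 1]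
  by (intro prob_spaceI) (simp add: gauss_real_def emeasure_density)

locale pos_def_form =
  fixes A :: "real^'n^'n"
  assumes sym: "transpose A = A" and pos: "pos_def_matrix A"
begin

abbreviation B where "B \<equiv> bform A"

lemmas B_simps = bform_linear[of A]

lemma B_commute: "B x y = B y x"
  by (rule bform_symmetric[OF sym])

lemma B_pos: "x \<noteq> 0 \<Longrightarrow> B x x > 0"
  using pos by (auto simp: bform_def pos_def_matrix_def)

lemma B_eq_0 [simp]: "B x x = 0 \<longleftrightarrow> x = 0"
  using B_pos[of x] by (cases "x = 0") (auto simp: B_simps)

lemma det_pos: "det A > 0"
  using gaussian_integral[OF sym pos] by simp

lemma prob_space_gauss: "prob_space (gauss A)"
proof (rule prob_spaceI)
  have "emeasure (gauss A) (space (gauss A)) =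
      (\<integral>\<^sup>+y. ennreal (sqrt (det A)) * ennreal (exp (- pi * bform A y y)) \<partial>lborel)"
    using det_pos by (simp add: gauss_def emeasure_density ennreal_mult)
  also have "\<dots> = ennreal (sqrt (det A)) * ennreal (1 / sqrt (det A))"
    using gaussian_integral[OF sym pos] by (subst nn_integral_cmult) auto
  also have "\<dots> = 1"
    using det_pos by (simp flip: ennreal_mult)
  finally show "emeasure (gauss A) (space (gauss A)) = 1" .
qed

sublocale G: prob_space "gauss A" by (rule prob_space_gauss)
sublocale N: prob_space gauss_real by (rule prob_space_gauss_real)
sublocale GN: pair_prob_space "gauss A" gauss_real ..

text \<open>For a unit vector \<open>e\<close>, the component of a \<open>gauss A\<close>-random vector along \<open>e\<close> has the law
\<open>gauss_real\<close> and is independent of the component orthogonal to \<open>e\<close>. This is expressed without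
coordinates: the \<open>e\<close>-component may be replaced by an independent sample \<open>t\<close>. The map behind it,
which exchanges \<open>B e y\<close> and \<open>t\<close> up to sign, is a composition of translations in one variable by
amounts depending on the other, and it preserves \<open>B y y + t\<^sup>2\<close>.\<close>
lemma nn_integral_resample:
  assumes e: "B e e = 1" and [measurable]: "f \<in> borel_measurable borel"
  shows "(\<integral>\<^sup>+y. (\<integral>\<^sup>+t. f (y - B e y *\<^sub>R e + t *\<^sub>R e) \<partial>gauss_real) \<partial>gauss A)
    = (\<integral>\<^sup>+y. f y \<partial>gauss A)"
proof -
  define w where "w y = ennreal (sqrt (det A) * exp (- pi * B y y))" for y
  define v where "v t = ennreal (exp (- pi * t\<^sup>2))" for t :: real
  have [measurable]: "w \<in> borel_measurable borel" "v \<in> borel_measurable borel"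
    unfolding w_def v_def by measurable
  have swap: "w (- (t *\<^sub>R e) + y) * v (B e y) = w y * v (- B e y + t)" for t y
  proof -
    have "B (- (t *\<^sub>R e) + y) (- (t *\<^sub>R e) + y) + (B e y)\<^sup>2 = B y y + (- B e y + t)\<^sup>2"
      using e B_commute[of y e] by (simp add: B_simps power2_eq_square algebra_simps)
    then have "exp (- pi * B (- (t *\<^sub>R e) + y) (- (t *\<^sub>R e) + y)) * exp (- pi * (B e y)\<^sup>2)
        = exp (- pi * B y y) * exp (- pi * (- B e y + t)\<^sup>2)"
      unfolding exp_add[symmetric] distrib_left[symmetric] by simp
    then show ?thesis
      using det_pos unfolding w_def v_def by (simp flip: ennreal_mult)
  qed
  have v1: "(\<integral>\<^sup>+t. v (a + t) \<partial>lborel) = 1" for a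
    using nn_integral_lborel_translate[of v a] nn_integral_gaussian_real[of 1] by (simp add: v_def)
  have "(\<integral>\<^sup>+y. (\<integral>\<^sup>+t. f (y - B e y *\<^sub>R e + t *\<^sub>R e) \<partial>gauss_real) \<partial>gauss A)
      = (\<integral>\<^sup>+y. w y * (\<integral>\<^sup>+t. v t * f (y - B e y *\<^sub>R e + t *\<^sub>R e) \<partial>lborel) \<partial>lborel)"
    by (simp add: gauss_def gauss_real_def w_def v_def nn_integral_density)
  also have "\<dots> = (\<integral>\<^sup>+y. w y * (\<integral>\<^sup>+t. v (B e y + t) * f (t *\<^sub>R e + y) \<partial>lborel) \<partial>lborel)"
  proof (rule nn_integral_cong, rule arg_cong2[where f="(*)"])
    fix y
    show "(\<integral>\<^sup>+t. v t * f (y - B e y *\<^sub>R e + t *\<^sub>R e) \<partial>lborel)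
        = (\<integral>\<^sup>+t. v (B e y + t) * f (t *\<^sub>R e + y) \<partial>lborel)"
      using nn_integral_lborel_translate[where f="\<lambda>t. v t * f (y - B e y *\<^sub>R e + t *\<^sub>R e)"
          and a="B e y"] by (simp add: algebra_simps)
  qed simp
  also have "\<dots> = (\<integral>\<^sup>+y. (\<integral>\<^sup>+t. w y * v (B e y + t) * f (t *\<^sub>R e + y) \<partial>lborel) \<partial>lborel)"
    by (simp add: nn_integral_cmult mult.assoc)
  also have "\<dots> = (\<integral>\<^sup>+t. (\<integral>\<^sup>+y. w y * v (B e y + t) * f (t *\<^sub>R e + y) \<partial>lborel) \<partial>lborel)"
    by (rule lborel_pair.Fubini') measurable
  also have "\<dots> = (\<integral>\<^sup>+t. (\<integral>\<^sup>+y. w (- (t *\<^sub>R e) + y) * v (B e y) * f y \<partial>lborel) \<partial>lborel)"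
  proof (rule nn_integral_cong)
    fix t
    show "(\<integral>\<^sup>+y. w y * v (B e y + t) * f (t *\<^sub>R e + y) \<partial>lborel)
        = (\<integral>\<^sup>+y. w (- (t *\<^sub>R e) + y) * v (B e y) * f y \<partial>lborel)"
      using nn_integral_lborel_translate[where f="\<lambda>y. w y * v (B e y + t) * f (t *\<^sub>R e + y)"
          and a="- (t *\<^sub>R e)"] e by (simp add: B_simps)
  qed
  also have "\<dots> = (\<integral>\<^sup>+y. (\<integral>\<^sup>+t. w (- (t *\<^sub>R e) + y) * v (B e y) * f y \<partial>lborel) \<partial>lborel)"
    by (rule lborel_pair.Fubini') measurable
  also have "\<dots> = (\<integral>\<^sup>+y. w y * f y \<partial>lborel)"
    unfolding swap using v1
    by (intro nn_integral_cong)
      (simp add: nn_integral_cmult nn_integral_multc mult_ac del: uminus_add_conv_diff)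
  also have "\<dots> = (\<integral>\<^sup>+y. f y \<partial>gauss A)"
    by (simp add: gauss_def w_def nn_integral_density)
  finally show ?thesis .
qed

lemma integral_resample:
  fixes h :: "real^'n \<Rightarrow> real"
  assumes e: "B e e = 1" and h [measurable]: "h \<in> borel_measurable borel" and bd: "\<And>y. \<bar>h y\<bar> \<le> C"
  shows "(LINT y|gauss A. h y)
    = (LINT t|gauss_real. LINT y|gauss A. h (y - B e y *\<^sub>R e + t *\<^sub>R e))"
proof -
  let ?\<psi> = "\<lambda>(y, t). y - B e y *\<^sub>R e + t *\<^sub>R e"
  let ?P = "gauss A \<Otimes>\<^sub>M gauss_real"
  have [measurable]: "?\<psi> \<in> borel_measurable ?P" by measurable
  have distr: "distr ?P borel ?\<psi> = gauss A"
  proof (rule measure_eqI)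
    fix X assume "X \<in> sets (distr ?P borel ?\<psi>)"
    then have [measurable]: "X \<in> sets borel" by simp
    have "emeasure (distr ?P borel ?\<psi>) X = (\<integral>\<^sup>+p. indicator X (?\<psi> p) \<partial>?P)"
      using nn_integral_distr[of ?\<psi> ?P borel "indicator X"] by simp
    also have "\<dots> = (\<integral>\<^sup>+y. (\<integral>\<^sup>+t. indicator X (y - B e y *\<^sub>R e + t *\<^sub>R e) \<partial>gauss_real) \<partial>gauss A)"
      by (subst N.nn_integral_fst[symmetric]) auto
    also have "\<dots> = (\<integral>\<^sup>+y. indicator X y \<partial>gauss A)"
      by (rule nn_integral_resample[OF e]) measurable
    also have "\<dots> = emeasure (gauss A) X" by simp
    finally show "emeasure (distr ?P borel ?\<psi>) X = emeasure (gauss A) X" .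
  qed simp
  have int: "integrable ?P (\<lambda>(y, t). h (y - B e y *\<^sub>R e + t *\<^sub>R e))"
    by (rule GN.P.integrable_const_bound[where B=C]) (use bd in auto)
  have "(LINT y|gauss A. h y) = (LINT p|?P. h (?\<psi> p))"
    by (subst distr[symmetric], subst integral_distr) auto
  also have "\<dots> = (LINT t|gauss_real. LINT y|gauss A. h (y - B e y *\<^sub>R e + t *\<^sub>R e))"
    using GN.integral_snd[OF int] by (simp add: case_prod_unfold)
  finally show ?thesis .
qed

end

section \<open>Orthogonal projection and Gram--Schmidt\<close>

definition lin_indep_family :: "(nat \<Rightarrow> 'a::real_vector) \<Rightarrow> nat set \<Rightarrow> bool" where
  "lin_indep_family m I \<longleftrightarrow> (\<forall>k\<in>I. m k \<notin> span (m ` (I - {k})))"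

lemma lin_indep_familyI:
  assumes "inj_on m I" "independent (m ` I)"
  shows "lin_indep_family m I"
  unfolding lin_indep_family_def
proof
  fix k assume k: "k \<in> I"
  then have "m ` (I - {k}) = m ` I - {m k}"
    using assms(1) by (auto simp: inj_on_def)
  then show "m k \<notin> span (m ` (I - {k}))"
    using assms(2) k by (auto simp: dependent_def)
qed

lemma span_diff_cancel: "v \<in> span V \<Longrightarrow> v - p \<in> span V \<Longrightarrow> p \<in> span V"
  using span_diff[of v V "v - p"] by simp

context pos_def_form
begin

lemma B_orthogonal_span:
  assumes "\<And>u. u \<in> V \<Longrightarrow> B u p = 0" "u \<in> span V"
  shows "B u p = 0"
  using assms(2) by (induction rule: span_induct_alt) (auto simp: B_simps assms(1))

lemma B_projection_unique:
  assumes "v - p \<in> span V" "\<And>u. u \<in> span V \<Longrightarrow> B u p = 0"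
    and "v - q \<in> span V" "\<And>u. u \<in> span V \<Longrightarrow> B u q = 0"
  shows "p = q"
proof -
  have "p - q \<in> span V" using span_diff[OF assms(3,1)] by simp
  then have "B (p - q) (p - q) = 0" using assms(2,4) by (simp add: B_simps(5))
  then show ?thesis by simp
qed

text \<open>Gram--Schmidt one vector at a time: when \<open>a\<close> is added to \<open>V\<close>, its own residual \<open>q\<close> is the only new
direction to be removed. If \<open>q = 0\<close>, the quotient below is \<open>0\<close> and nothing is removed.\<close>
lemma B_projection_exists:
  assumes "finite V"
  shows "\<exists>p. v - p \<in> span V \<and> (\<forall>u\<in>span V. B u p = 0)"
  using assms
proof (induction V arbitrary: v)
  case empty
  show ?case by (rule exI[of _ v]) (auto simp: B_simps)
next
  case (insert a V)
  obtain p where p: "v - p \<in> span V" "\<And>u. u \<in> span V \<Longrightarrow> B u p = 0" using insert.IH by blast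
  obtain q where q: "a - q \<in> span V" "\<And>u. u \<in> span V \<Longrightarrow> B u q = 0" using insert.IH by blast
  have sub: "span V \<subseteq> span (insert a V)" by (rule span_mono) auto
  define p' where "p' = p - (B q p / B q q) *\<^sub>R q"
  have "q \<in> span (insert a V)"
    using q(1) sub by (intro span_diff_cancel[of a _ q]) (auto intro: span_base)
  then have "(v - p) + (B q p / B q q) *\<^sub>R q \<in> span (insert a V)"
    using p(1) sub by (intro span_add span_scale) auto
  then have "v - p' \<in> span (insert a V)" by (simp add: p'_def algebra_simps)
  moreover have "B u p' = 0" if "u \<in> span (insert a V)" for u
  proof (rule B_orthogonal_span[OF _ that])
    fix u assume "u \<in> insert a V"
    have orth: "B u p' = 0" if "u \<in> span V" for u
      using that by (simp add: p'_def B_simps p q)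
    have "B a p' = B (a - q) p' + B q p'" by (simp add: B_simps)
    also have "\<dots> = 0" using orth[OF q(1)] by (cases "q = 0") (auto simp: p'_def B_simps)
    finally show "B u p' = 0" using \<open>u \<in> insert a V\<close> orth by (auto intro: span_base)
  qed
  ultimately show ?case by blast
qed

lemma proj_perp_eqI:
  assumes "m k - p \<in> span (m ` S)" "\<And>u. u \<in> m ` S \<Longrightarrow> B u p = 0"
  shows "proj_perp A m S k = p"
  unfolding proj_perp_def
proof (rule the_equality)
  show "m k - p \<in> span (m ` S) \<and> (\<forall>u\<in>span (m ` S). B u p = 0)"
    using assms B_orthogonal_span by blast
  then show "q = p" if "m k - q \<in> span (m ` S) \<and> (\<forall>u\<in>span (m ` S). B u q = 0)" for q
    using that B_projection_unique[of "m k" q "m ` S" p] by blast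
qed

lemma
  assumes "finite S"
  shows proj_perp_diff_in_span: "m k - proj_perp A m S k \<in> span (m ` S)"
    and proj_perp_orthogonal: "u \<in> span (m ` S) \<Longrightarrow> B u (proj_perp A m S k) = 0"
proof -
  obtain p where p: "m k - p \<in> span (m ` S)" "\<And>u. u \<in> span (m ` S) \<Longrightarrow> B u p = 0"
    using B_projection_exists[of "m ` S" "m k"] assms by blast
  then have "proj_perp A m S k = p" by (intro proj_perp_eqI) (auto intro: span_base)
  then show "m k - proj_perp A m S k \<in> span (m ` S)"
    "u \<in> span (m ` S) \<Longrightarrow> B u (proj_perp A m S k) = 0" using p by auto
qed

lemma proj_perp_empty [simp]: "proj_perp A m {} k = m k"
  by (rule proj_perp_eqI) auto

lemma proj_perp_singleton:
  "proj_perp A m {k} i = m i - (B (m k) (m i) / B (m k) (m k)) *\<^sub>R m k"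
  by (rule proj_perp_eqI) (auto simp: B_simps intro: span_scale span_base)

text \<open>Projections can be carried out in stages. Hence a recursion that removes one vector at a time and
projects the others produces exactly the families \<open>proj_perp A m S\<close>.\<close>
lemma proj_perp_insert:
  assumes S: "finite S"
  shows "proj_perp A m (insert k S) = proj_perp A (proj_perp A m S) {k}"
proof
  fix i
  let ?q = "proj_perp A m S k" and ?p = "proj_perp A m S i"
  have sub: "span (m ` S) \<subseteq> span (m ` insert k S)" by (rule span_mono) auto
  define c where "c = B ?q ?p / B ?q ?q"
  have p': "proj_perp A (proj_perp A m S) {k} i = ?p - c *\<^sub>R ?q"
    by (simp add: proj_perp_singleton c_def)
  have orth: "B u (?p - c *\<^sub>R ?q) = 0" if "u \<in> span (m ` S)" for u
    using that by (simp add: B_simps proj_perp_orthogonal[OF S])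
  show "proj_perp A m (insert k S) i = proj_perp A (proj_perp A m S) {k} i"
    unfolding p'
  proof (rule proj_perp_eqI)
    have "?q \<in> span (m ` insert k S)"
      using proj_perp_diff_in_span[OF S] sub
      by (intro span_diff_cancel[of "m k" _ ?q]) (auto intro: span_base)
    then have "(m i - ?p) + c *\<^sub>R ?q \<in> span (m ` insert k S)"
      using proj_perp_diff_in_span[OF S] sub by (intro span_add span_scale) auto
    then show "m i - (?p - c *\<^sub>R ?q) \<in> span (m ` insert k S)" by (simp add: algebra_simps)
    fix u assume u: "u \<in> m ` insert k S"
    have "B (m k) (?p - c *\<^sub>R ?q) = B (m k - ?q) (?p - c *\<^sub>R ?q) + B ?q (?p - c *\<^sub>R ?q)"
      by (simp add: B_simps algebra_simps)
    also have "\<dots> = 0"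
      using orth[OF proj_perp_diff_in_span[OF S]]
      by (cases "?q = 0") (auto simp: B_simps c_def)
    finally show "B u (?p - c *\<^sub>R ?q) = 0" using u orth by (auto intro: span_base)
  qed
qed

lemma proj_perp_reindex: "proj_perp A (\<lambda>i. m (\<sigma> i)) S k = proj_perp A m (\<sigma> ` S) (\<sigma> k)"
  by (simp add: proj_perp_def image_image)

lemma proj_perp_nonzero:
  assumes "lin_indep_family m I" "finite I" "S \<subseteq> I" "k \<in> I - S"
  shows "proj_perp A m S k \<noteq> 0"
proof
  assume "proj_perp A m S k = 0"
  then have "m k \<in> span (m ` S)"
    using proj_perp_diff_in_span[of S m k] assms finite_subset by auto
  moreover have "span (m ` S) \<subseteq> span (m ` (I - {k}))" by (rule span_mono) (use assms in auto)
  ultimately show False using assms by (auto simp: lin_indep_family_def)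
qed

lemma proj_perp_nonparallel:
  assumes "lin_indep_family m I" "finite I" "S \<subseteq> I" "k \<in> I - S" "l \<in> I - S" "k \<noteq> l"
    and eq: "a *\<^sub>R proj_perp A m S k = b *\<^sub>R proj_perp A m S l"
  shows "a = 0"
proof (rule ccontr)
  assume "a \<noteq> 0"
  let ?p = "proj_perp A m S"
  have S: "finite S" using assms finite_subset by auto
  let ?V = "span (m ` (I - {k}))"
  have sub: "span (m ` S) \<subseteq> ?V" by (rule span_mono) (use assms in auto)
  have in_V: "m i - ?p i \<in> ?V" for i using proj_perp_diff_in_span[OF S] sub by blast
  have "?p l \<in> ?V"
    using in_V assms by (intro span_diff_cancel[of "m l" _ "?p l"]) (auto intro: span_base)
  then have "(b / a) *\<^sub>R ?p l \<in> ?V" by (intro span_scale) simp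
  moreover have "(b / a) *\<^sub>R ?p l = ?p k"
    using eq \<open>a \<noteq> 0\<close> by (metis divide_inverse_commute scaleR_left_imp_eq scaleR_scaleR
        divide_self_if mult.commute nonzero_mult_div_cancel_left scaleR_one times_divide_eq_right)
  ultimately have "(m k - ?p k) + ?p k \<in> ?V" using in_V by (intro span_add) auto
  then show False using assms by (auto simp: lin_indep_family_def)
qed

definition normalize_B :: "real^'n \<Rightarrow> real^'n" where
  "normalize_B v = v /\<^sub>R sqrt (B v v)"

lemma normalize_B_unit: "v \<noteq> 0 \<Longrightarrow> B (normalize_B v) (normalize_B v) = 1"
  using B_pos[of v] by (simp add: normalize_B_def B_simps field_simps)

lemma normalize_B_scale: "sqrt (B v v) *\<^sub>R normalize_B v = v"
  by (cases "v = 0") (auto simp: normalize_B_def)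

text \<open>The vector produced at step \<open>j\<close> before normalization, \<open>w\<close>, differs from \<open>u j\<close> by a combination
of the earlier vectors and is orthogonal to them, so it is the projection of \<open>u j\<close>. That it is
orthogonal to the original vectors \<open>u i\<close> as well follows by a second induction, since \<open>u i\<close> is a
multiple of \<open>gram_schmidt_B A u i\<close> plus an element of the span of \<open>u 1, \<dots>, u (i - 1)\<close>.\<close>
lemma gram_schmidt_B_eq:
  assumes u: "lin_indep_family u {1..r}" and "j \<in> {1..r}"
  shows "gram_schmidt_B A u j = normalize_B (proj_perp A u {1..<j} j)"
  using assms(2)
proof (induction j rule: less_induct)
  case (less j)
  let ?v = "gram_schmidt_B A u"
  let ?p = "\<lambda>i. proj_perp A u {1..<i} i"
  have v: "?v i = normalize_B (?p i)" if "i \<in> {1..<j}" for i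
    using less that by auto
  have unit: "B (?v i) (?v i) = 1" if "i \<in> {1..<j}" for i
    unfolding v[OF that]
    by (rule normalize_B_unit, rule proj_perp_nonzero[OF u]) (use that less in auto)
  have p_span: "?p i \<in> span (u ` {1..<Suc i})" if "1 \<le> i" for i
  proof (rule span_diff_cancel)
    show "u i \<in> span (u ` {1..<Suc i})" using that by (auto intro: span_base)
    show "u i - ?p i \<in> span (u ` {1..<Suc i})"
      using proj_perp_diff_in_span[of "{1..<i}" u i] span_mono[of "u ` {1..<i}" "u ` {1..<Suc i}"]
      by fastforce
  qed
  have orth_lt: "B (?v i) (?v l) = 0" if "i \<in> {1..<j}" "l \<in> {1..<j}" "i < l" for i l
  proof -
    have "?p i \<in> span (u ` {1..<l})"
      using p_span[of i] that span_mono[of "u ` {1..<Suc i}" "u ` {1..<l}"] by fastforce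
    then show ?thesis
      using proj_perp_orthogonal[of "{1..<l}" "?p i" u l] that by (simp add: v normalize_B_def B_simps)
  qed
  have orth: "B (?v i) (?v l) = (if i = l then 1 else 0)" if "i \<in> {1..<j}" "l \<in> {1..<j}" for i l
    using orth_lt[of i l] orth_lt[of l i] unit that B_commute[of "?v i"] by (metis nat_neq_iff)
  define w where "w = u j - (\<Sum>i\<in>{1..<j}. B (u j) (?v i) *\<^sub>R ?v i)"
  have w_orth: "B (?v l) w = 0" if l: "l \<in> {1..<j}" for l
  proof -
    have "B (?v l) (\<Sum>i\<in>F. B (u j) (?v i) *\<^sub>R ?v i) = (\<Sum>i\<in>F. B (u j) (?v i) * B (?v l) (?v i))" for F
      by (induction F rule: infinite_finite_induct) (auto simp: B_simps)
    then have "B (?v l) w = B (?v l) (u j) - (\<Sum>i\<in>{1..<j}. B (u j) (?v i) * B (?v l) (?v i))"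
      by (simp add: w_def B_simps)
    also have "(\<Sum>i\<in>{1..<j}. B (u j) (?v i) * B (?v l) (?v i))
        = (\<Sum>i\<in>{1..<j}. if i = l then B (u j) (?v l) else 0)"
      using l by (intro sum.cong) (auto simp: orth)
    finally show ?thesis using l B_commute[of "?v l"] by simp
  qed
  have "proj_perp A u {1..<j} j = w"
  proof (rule proj_perp_eqI)
    have "?v i \<in> span (u ` {1..<j})" if "i \<in> {1..<j}" for i
      using p_span[of i] that span_mono[of "u ` {1..<Suc i}" "u ` {1..<j}"]
      unfolding v[OF that] normalize_B_def by (intro span_scale) fastforce
    then show "u j - w \<in> span (u ` {1..<j})"
      by (auto simp: w_def intro!: span_sum span_scale)
    have "B (u i) w = 0" if "i \<in> {1..<j}" for i
      using that
    proof (induction i rule: less_induct)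
      case (less i)
      have "B y w = 0" if "y \<in> span (u ` {1..<i})" for y
        by (rule B_orthogonal_span[OF _ that]) (use less in auto)
      then have "B (u i - ?p i) w = 0" using proj_perp_diff_in_span[of "{1..<i}" u i] by simp
      moreover have "B (?p i) w = sqrt (B (?p i) (?p i)) * B (?v i) w"
        using normalize_B_scale[of "?p i"] v[OF less.prems] by (metis B_simps(3))
      ultimately show ?case using w_orth[OF less.prems] by (simp add: B_simps)
    qed
    then show "B y w = 0" if "y \<in> u ` {1..<j}" for y using that by auto
  qed
  then show ?case
    by (subst gram_schmidt_B.simps) (simp add: w_def normalize_B_def Let_def)
qed

end

section \<open>Jumps of products of signs\<close>

lemma sgn_affine_const:
  fixes \<alpha> c p q u :: real
  assumes "p \<le> u" "u \<le> q" "sgn (\<alpha> + c * p) = sgn (\<alpha> + c * q)" "\<alpha> + c * p \<noteq> 0"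
  shows "sgn (\<alpha> + c * u) = sgn (\<alpha> + c * p)"
proof -
  have "c * p \<le> c * u \<and> c * u \<le> c * q \<or> c * q \<le> c * u \<and> c * u \<le> c * p"
    using assms by (cases "c \<ge> 0") (auto intro: mult_left_mono mult_left_mono_neg)
  then show ?thesis using assms(3,4) by (auto simp: sgn_if split: if_splits)
qed

lemma sgn_affine_flip:
  fixes \<alpha> c p q :: real
  assumes "p \<le> q" "sgn (\<alpha> + c * p) \<noteq> sgn (\<alpha> + c * q)" "\<alpha> + c * p \<noteq> 0" "\<alpha> + c * q \<noteq> 0"
  shows "c \<noteq> 0" "p < - \<alpha> / c" "- \<alpha> / c < q"
    "u < - \<alpha> / c \<Longrightarrow> sgn (\<alpha> + c * u) = sgn (\<alpha> + c * p)"
    "u > - \<alpha> / c \<Longrightarrow> sgn (\<alpha> + c * u) = sgn (\<alpha> + c * q)"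
    "sgn (\<alpha> + c * p) = - sgn (\<alpha> + c * q)"
    "\<alpha> + c * (- \<alpha> / c) = 0"
proof -
  show c: "c \<noteq> 0" using assms(2) by auto
  define z where "z = - \<alpha> / c"
  have aff: "\<alpha> + c * v = c * (v - z)" for v using c by (simp add: z_def field_simps)
  have sgn_aff: "sgn (\<alpha> + c * v) = sgn c * sgn (v - z)" for v by (simp add: aff sgn_mult)
  have ne: "p \<noteq> z" "q \<noteq> z" "sgn (p - z) \<noteq> sgn (q - z)" using assms by (auto simp: aff sgn_mult)
  then have z: "p < z" "z < q" using assms(1) by (auto simp: sgn_if split: if_splits)
  show "p < - \<alpha> / c" "- \<alpha> / c < q" using z by (auto simp: z_def)
  show "u < - \<alpha> / c \<Longrightarrow> sgn (\<alpha> + c * u) = sgn (\<alpha> + c * p)"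
    "u > - \<alpha> / c \<Longrightarrow> sgn (\<alpha> + c * u) = sgn (\<alpha> + c * q)"
    "sgn (\<alpha> + c * p) = - sgn (\<alpha> + c * q)"
    using z unfolding sgn_aff z_def[symmetric] by auto
  show "\<alpha> + c * (- \<alpha> / c) = 0" using aff[of z] by (simp add: z_def)
qed

text \<open>A product of signs of affine functions is a step function. If no factor vanishes at the end points and
no two vanish at the same place, its increment over \<open>{p..q}\<close> is the sum of its jumps: factor \<open>k\<close> jumps at \<open>- \<alpha> k / c k\<close>, and
the jump is weighted by the values of the other factors there. Factors that do not change sign
contribute \<open>0\<close>, which covers \<open>c k = 0\<close> in spite of the division. The interval is cut at the zero of
the newly added factor, which is why the induction has to allow arbitrary end points.\<close>
lemma sgn_prod_jumps:
  fixes \<alpha> c :: "'i \<Rightarrow> real" and p q :: real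
  assumes "finite I" "p \<le> q"
    and "\<And>k. k \<in> I \<Longrightarrow> \<alpha> k + c k * p \<noteq> 0" "\<And>k. k \<in> I \<Longrightarrow> \<alpha> k + c k * q \<noteq> 0"
    and "\<And>k l. k \<in> I \<Longrightarrow> l \<in> I \<Longrightarrow> k \<noteq> l \<Longrightarrow> c k \<noteq> 0 \<Longrightarrow> \<alpha> l + c l * (- \<alpha> k / c k) \<noteq> 0"
  shows "(\<Prod>k\<in>I. sgn (\<alpha> k + c k * q)) - (\<Prod>k\<in>I. sgn (\<alpha> k + c k * p))
    = (\<Sum>k\<in>I. (sgn (\<alpha> k + c k * q) - sgn (\<alpha> k + c k * p))
        * (\<Prod>i\<in>I - {k}. sgn (\<alpha> i + c i * (- \<alpha> k / c k))))"
  using assms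
proof (induction I arbitrary: p q rule: finite_induct)
  case empty
  show ?case by simp
next
  case (insert a I)
  define f where "f k u = sgn (\<alpha> k + c k * u)" for k u
  define z where "z k = - \<alpha> k / c k" for k
  define W where "W k = (\<Prod>i\<in>I - {k}. f i (z k))" for k
  have IH: "(\<Prod>k\<in>I. f k q) - (\<Prod>k\<in>I. f k p) = (\<Sum>k\<in>I. (f k q - f k p) * W k)"
    if "p \<le> q" "\<And>k. k \<in> I \<Longrightarrow> \<alpha> k + c k * p \<noteq> 0" "\<And>k. k \<in> I \<Longrightarrow> \<alpha> k + c k * q \<noteq> 0" for p q
    unfolding f_def W_def z_def
    by (rule insert.IH[OF that]) (use insert.prems(4) in auto)
  have W_insert: "(\<Prod>i\<in>insert a I - {k}. f i (z k)) = f a (z k) * W k" if "k \<in> I" for k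
  proof -
    have "insert a I - {k} = insert a (I - {k})" using that insert.hyps by auto
    then show ?thesis using insert.hyps by (simp add: W_def)
  qed
  have W_a: "(\<Prod>i\<in>insert a I - {a}. f i (z a)) = (\<Prod>i\<in>I. f i (z a))"
    using insert.hyps by simp
  note const = sgn_affine_const[where \<alpha>="\<alpha> k" and c="c k" for k, folded f_def]
  note flip = sgn_affine_flip[where \<alpha>="\<alpha> k" and c="c k" for k, folded f_def z_def]
  have p: "\<alpha> k + c k * p \<noteq> 0" and q: "\<alpha> k + c k * q \<noteq> 0" if "k \<in> insert a I" for k
    using insert.prems that by blast+
  have "f a q * (\<Prod>k\<in>I. f k q) - f a p * (\<Prod>k\<in>I. f k p)
    = (f a q - f a p) * (\<Prod>i\<in>I. f i (z a)) + (\<Sum>k\<in>I. (f k q - f k p) * (f a (z k) * W k))"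
  proof (cases "f a p = f a q")
    case True
    have "f a p * ((f k q - f k p) * W k) = (f k q - f k p) * (f a (z k) * W k)" if k: "k \<in> I" for k
    proof (cases "f k p = f k q")
      case False
      note fl = flip[OF \<open>p \<le> q\<close> False p[OF insertI2[OF k]] q[OF insertI2[OF k]]]
      have "f a (z k) = f a p"
        using const[of p "z k" q a] True fl(2,3) k p[of a] by auto
      then show ?thesis by simp
    qed simp
    then have "f a p * (\<Sum>k\<in>I. (f k q - f k p) * W k) = (\<Sum>k\<in>I. (f k q - f k p) * (f a (z k) * W k))"
      unfolding sum_distrib_left by (rule sum.cong[OF refl])
    then show ?thesis
      using True IH[OF \<open>p \<le> q\<close> p q] by (simp flip: right_diff_distrib)
  next
    case False
    \<comment> \<open>The new factor is \<open>- f a q\<close> before its zero \<open>?r\<close> and \<open>f a q\<close> after it.\<close>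
    note fa = flip[OF \<open>p \<le> q\<close> False p[OF insertI1] q[OF insertI1]]
    let ?r = "z a"
    have r: "\<alpha> k + c k * ?r \<noteq> 0" if "k \<in> I" for k
      unfolding z_def using insert.prems(4)[of a k] that insert.hyps fa(1) by auto
    have upper: "(\<Prod>k\<in>I. f k q) - (\<Prod>k\<in>I. f k ?r) = (\<Sum>k\<in>I. (f k q - f k ?r) * W k)"
      by (rule IH) (use fa(3) r q in auto)
    have lower: "(\<Prod>k\<in>I. f k ?r) - (\<Prod>k\<in>I. f k p) = (\<Sum>k\<in>I. (f k ?r - f k p) * W k)"
      by (rule IH) (use fa(2) r p in auto)
    have "f a q * ((f k q - f k ?r) * W k) - f a q * ((f k ?r - f k p) * W k)
        = (f k q - f k p) * (f a (z k) * W k)" if k: "k \<in> I" for k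
    proof -
      have up: "z k > ?r" if "f k ?r \<noteq> f k q"
        using flip(2)[of ?r q k] that fa(3) r[OF k] q[of k] k by auto
      have low: "z k < ?r" if "f k p \<noteq> f k ?r"
        using flip(3)[of p ?r k] that fa(2) r[OF k] p[of k] k by auto
      consider "f k p = f k ?r" "f k ?r = f k q" | "f k ?r \<noteq> f k q" "f k p = f k ?r"
        | "f k p \<noteq> f k ?r" "f k ?r = f k q"
        using up low by fastforce
      then show ?thesis
      proof cases
        case 2
        then show ?thesis using fa(5)[OF up] by simp
      next
        case 3
        then show ?thesis using fa(4)[OF low] fa(6) by simp
      qed simp
    qed
    then have "f a q * (\<Sum>k\<in>I. (f k q - f k ?r) * W k) - f a q * (\<Sum>k\<in>I. (f k ?r - f k p) * W k)
        = (\<Sum>k\<in>I. (f k q - f k p) * (f a (z k) * W k))"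
      unfolding sum_distrib_left sum_subtractf[symmetric] by (rule sum.cong[OF refl])
    then show ?thesis
      unfolding upper[symmetric] lower[symmetric] using fa(6) by (simp add: algebra_simps)
  qed
  moreover have "(\<Sum>k\<in>I. (f k q - f k p) * (f a (z k) * W k))
      = (\<Sum>k\<in>I. (f k q - f k p) * (\<Prod>i\<in>insert a I - {k}. f i (z k)))"
    by (rule sum.cong) (auto simp: W_insert)
  ultimately show ?case
    unfolding f_def[symmetric] z_def[symmetric] using insert.hyps W_a by simp
qed

section \<open>The error function along a ray\<close>

lemma integral_lborel_translate:
  fixes f :: "'a::euclidean_space \<Rightarrow> real"
  assumes [measurable]: "f \<in> borel_measurable borel"
  shows "(LINT x|lborel. f (a + x)) = (LINT x|lborel. f x)"
  by (subst (2) lborel_distr_plus[of a, symmetric]) (simp add: integral_distr)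

context pos_def_form
begin

lemma sgn_B_measurable [measurable]: "sgn_B A m I \<in> borel_measurable borel"
  unfolding sgn_B_def by measurable

lemma abs_sgn_B_le: "\<bar>sgn_B A m I y\<bar> \<le> 1"
  unfolding sgn_B_def abs_prod by (rule prod_le_1) (auto simp: abs_sgn_eq)

lemma integrable_gauss_bounded:
  fixes h :: "real^'n \<Rightarrow> real"
  assumes [measurable]: "h \<in> borel_measurable borel" and "\<And>y. \<bar>h y\<bar> \<le> C"
  shows "integrable (gauss A) h"
  by (rule G.integrable_const_bound[where B=C]) (use assms in auto)

text \<open>For \<open>I = {}\<close> the value \<open>1\<close> is fixed by definition; it agrees with the integral because \<open>gauss A\<close> has
total mass \<open>1\<close>.\<close>
lemma gen_erf_eq_gauss: "gen_erf A m I x = (LINT y|gauss A. sgn_B A m I (y + x))"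
proof (cases "I = {}")
  case True
  then show ?thesis using G.prob_space by (simp add: gen_erf_def sgn_B_def)
next
  case False
  let ?f = "\<lambda>y. sgn_B A m I y * exp (- 2 * pi * qform A (y - x))"
  have [measurable]: "(\<lambda>y. qform A (y - x)) \<in> borel_measurable borel"
    unfolding qform_def by measurable
  have "(LINT y|gauss A. sgn_B A m I (y + x))
      = (LINT y|lborel. sqrt (det A) * exp (- pi * B y y) * sgn_B A m I (y + x))"
    unfolding gauss_def using det_pos by (subst integral_density) auto
  also have "\<dots> = sqrt (det A) * (LINT y|lborel. ?f (x + y))"
    by (simp add: qform_def mult_ac add_ac flip: integral_mult_right_zero)
  also have "\<dots> = gen_erf A m I x"
    using False by (subst integral_lborel_translate) (auto simp: gen_erf_def)
  finally show ?thesis by simp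
qed

lemma AE_gauss_B_neq:
  assumes "v \<noteq> 0"
  shows "AE y in gauss A. B v y \<noteq> b"
proof -
  have "A *v v \<noteq> 0" using B_pos[OF assms] by (auto simp: bform_def)
  moreover have B: "B v y = (A *v v) \<bullet> y" for y
    using B_commute[of v y] by (simp add: bform_def inner_commute)
  ultimately have "negligible {y. B v y = b}" using negligible_hyperplane[of "A *v v" b] by simp
  moreover have "{y. B v y = b} \<in> sets borel" by measurable
  ultimately have "{y. B v y = b} \<in> null_sets lborel"
    by (simp add: negligible_iff_null_sets null_sets_completion_iff)
  then have "AE y in lborel. y \<notin> {y. B v y = b}" by (rule AE_not_in)
  then have "AE y in lborel. B v y \<noteq> b" by simp
  then show ?thesis unfolding gauss_def by (subst AE_density) auto
qed

text \<open>Pairwise linear independence: it makes the signs of two members jump at different times along a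
generic line.\<close>
definition nonparallel_family :: "(nat \<Rightarrow> real^'n) \<Rightarrow> nat set \<Rightarrow> bool" where
  "nonparallel_family m I \<longleftrightarrow> (\<forall>k\<in>I. m k \<noteq> 0) \<and>
     (\<forall>k\<in>I. \<forall>l\<in>I. \<forall>a b. k \<noteq> l \<longrightarrow> a *\<^sub>R m k = b *\<^sub>R m l \<longrightarrow> a = 0)"

definition coord :: "(nat \<Rightarrow> real^'n) \<Rightarrow> real^'n \<Rightarrow> nat \<Rightarrow> real" where
  "coord m x k = B (normalize_B (m k)) x"

text \<open>For almost every \<open>y\<close>, no factor vanishes at the ends of the segment from \<open>y\<close> to \<open>y + s *\<^sub>R x\<close> and no
two factors vanish at the same place of it, since each coincidence confines \<open>y\<close> to a hyperplane:
factors \<open>k\<close> and \<open>l\<close> can vanish together only if \<open>B (m k) x *\<^sub>R m l - B (m l) x *\<^sub>R m k\<close> is orthogonal to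
\<open>y\<close>, and this vector is non-zero because \<open>m k\<close> and \<open>m l\<close> are not parallel.\<close>
lemma AE_sgn_B_jumps:
  assumes I: "finite I" and m: "nonparallel_family m I" and "0 \<le> s"
  shows "AE y in gauss A. sgn_B A m I (y + s *\<^sub>R x) - sgn_B A m I y
    = (\<Sum>k\<in>I. (sgn (B (m k) (y + s *\<^sub>R x)) - sgn (B (m k) y))
        * sgn_B A m (I - {k}) (y - (B (m k) y / B (m k) x) *\<^sub>R x))"
proof -
  have "AE y in gauss A. \<forall>k\<in>I. B (m k) y \<noteq> 0 \<and> B (m k) y \<noteq> - s * B (m k) x"
    using I m by (intro AE_finite_allI AE_conjI AE_gauss_B_neq) (auto simp: nonparallel_family_def)
  moreover have "AE y in gauss A. \<forall>k\<in>I. \<forall>l\<in>I. k \<noteq> l \<longrightarrow> B (m k) x \<noteq> 0 \<longrightarrow>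
      B (B (m k) x *\<^sub>R m l - B (m l) x *\<^sub>R m k) y \<noteq> 0"
    using I
  proof (intro AE_finite_allI AE_impI AE_gauss_B_neq)
    fix k l assume "k \<in> I" "l \<in> I" "k \<noteq> l" "B (m k) x \<noteq> 0"
    then show "B (m k) x *\<^sub>R m l - B (m l) x *\<^sub>R m k \<noteq> 0"
      using m unfolding nonparallel_family_def by (metis eq_iff_diff_eq_0)
  qed auto
  ultimately show ?thesis
  proof eventually_elim
    fix y
    assume 1: "\<forall>k\<in>I. B (m k) y \<noteq> 0 \<and> B (m k) y \<noteq> - s * B (m k) x"
      and 2: "\<forall>k\<in>I. \<forall>l\<in>I. k \<noteq> l \<longrightarrow> B (m k) x \<noteq> 0 \<longrightarrow>
        B (B (m k) x *\<^sub>R m l - B (m l) x *\<^sub>R m k) y \<noteq> 0"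
    have "(\<Prod>k\<in>I. sgn (B (m k) y + B (m k) x * s)) - (\<Prod>k\<in>I. sgn (B (m k) y + B (m k) x * 0))
      = (\<Sum>k\<in>I. (sgn (B (m k) y + B (m k) x * s) - sgn (B (m k) y + B (m k) x * 0))
        * (\<Prod>i\<in>I - {k}. sgn (B (m i) y + B (m i) x * (- B (m k) y / B (m k) x))))"
    proof (rule sgn_prod_jumps)
      fix k l assume "k \<in> I" "l \<in> I" "k \<noteq> l" "B (m k) x \<noteq> 0"
      then show "B (m l) y + B (m l) x * (- B (m k) y / B (m k) x) \<noteq> 0"
        using 2 by (auto simp: B_simps field_simps)
    qed (use assms 1 in \<open>auto simp: add_eq_0_iff mult.commute\<close>)
    then show "sgn_B A m I (y + s *\<^sub>R x) - sgn_B A m I y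
      = (\<Sum>k\<in>I. (sgn (B (m k) (y + s *\<^sub>R x)) - sgn (B (m k) y))
        * sgn_B A m (I - {k}) (y - (B (m k) y / B (m k) x) *\<^sub>R x))"
      by (simp add: sgn_B_def B_simps mult.commute)
  qed
qed

lemma gen_erf_line_measurable [measurable]:
  "(\<lambda>u. gen_erf A m I (u *\<^sub>R x)) \<in> borel_measurable borel"
  unfolding gen_erf_eq_gauss by measurable

lemma abs_gen_erf_le: "\<bar>gen_erf A m I x\<bar> \<le> 1"
proof -
  have "\<bar>gen_erf A m I x\<bar> \<le> (LINT y|gauss A. \<bar>sgn_B A m I (y + x)\<bar>)"
    unfolding gen_erf_eq_gauss by (rule integral_abs_bound)
  also have "\<dots> \<le> (LINT y|gauss A. 1)"
    by (rule integral_mono) (auto intro!: integrable_gauss_bounded[where C=1] abs_sgn_B_le)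
  also have "\<dots> = 1" using G.prob_space by simp
  finally show ?thesis .
qed

text \<open>The mean contribution of one jump. The component \<open>t\<close> of \<open>y\<close> along the unit vector \<open>e\<close> of \<open>m k\<close>
decides when the jump happens, namely at \<open>u = - t / c\<close>; resampling \<open>t\<close> separates it from the rest.
At that time \<open>y + u *\<^sub>R x\<close> is orthogonal to \<open>e\<close>, so the other signs depend only on the projections of
the \<open>m i\<close> to the complement of \<open>m k\<close>, and their mean is the error function of the projected family.
The substitution \<open>t = - c * u\<close> turns the Gaussian law of \<open>t\<close> into the density of the jump time.\<close>
lemma jump_integral:
  fixes x :: "real^'n" and m :: "nat \<Rightarrow> real^'n" and k :: nat
  assumes mk: "m k \<noteq> 0" and s: "0 \<le> s"
  defines "c \<equiv> coord m x k"
  shows "(LINT y|gauss A. (sgn (B (m k) (y + s *\<^sub>R x)) - sgn (B (m k) y))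
        * sgn_B A m J (y - (B (m k) y / B (m k) x) *\<^sub>R x))
    = integral {0..s} (\<lambda>u. 2 * c * exp (- pi * c\<^sup>2 * u\<^sup>2)
        * gen_erf A (proj_perp A m {k}) J (u *\<^sub>R x))"
proof (cases "c = 0")
  case True
  then have "B (m k) x = 0" using normalize_B_scale[of "m k"]
    by (metis B_simps(3) c_def coord_def mult_zero_right)
  then show ?thesis using True by (simp add: B_simps)
next
  case False
  define e where "e = normalize_B (m k)"
  define N where "N = sqrt (B (m k) (m k))"
  have N: "N > 0" using B_pos[OF mk] by (simp add: N_def)
  have mk_e: "m k = N *\<^sub>R e" by (simp add: e_def N_def normalize_B_scale)
  have e1: "B e e = 1" using normalize_B_unit[OF mk] by (simp add: e_def)
  have c: "c = B e x" by (simp add: c_def coord_def e_def)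
  define H where "H u = gen_erf A (proj_perp A m {k}) J (u *\<^sub>R x)" for u
  have [measurable]: "H \<in> borel_measurable borel" unfolding H_def by measurable
  have H_le: "\<bar>H u\<bar> \<le> 1" for u unfolding H_def by (rule abs_gen_erf_le)
  have perp: "proj_perp A m {k} i = m i - B e (m i) *\<^sub>R e" for i
    using N e1 by (simp add: proj_perp_singleton mk_e B_simps)
  define h where "h y = (sgn (B e y + s * c) - sgn (B e y))
      * sgn_B A m J (y - (B e y / c) *\<^sub>R x)" for y
  have sgn_mk: "sgn (B (m k) y) = sgn (B e y)" for y using N by (simp add: mk_e B_simps sgn_mult)
  have ratio: "B (m k) y / B (m k) x = B e y / c" for y using N by (simp add: mk_e B_simps c)
  have "(LINT y|gauss A. (sgn (B (m k) (y + s *\<^sub>R x)) - sgn (B (m k) y))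
        * sgn_B A m J (y - (B (m k) y / B (m k) x) *\<^sub>R x)) = (LINT y|gauss A. h y)"
    unfolding sgn_mk ratio by (simp add: h_def B_simps c)
  also have "\<dots> = (LINT t|gauss_real. LINT y|gauss A. h (y - B e y *\<^sub>R e + t *\<^sub>R e))"
  proof (rule integral_resample[OF e1])
    show "h \<in> borel_measurable borel" unfolding h_def by measurable
    fix y
    have "\<bar>h y\<bar> \<le> 2 * 1"
      unfolding h_def abs_mult by (intro mult_mono abs_sgn_B_le) (auto simp: sgn_if)
    then show "\<bar>h y\<bar> \<le> 2" by simp
  qed
  also have "\<dots> = (LINT t|gauss_real. (sgn (t + s * c) - sgn t) * H (- t / c))"
  proof (rule Bochner_Integration.integral_cong[OF refl])
    fix t
    have "B (m i) (y - B e y *\<^sub>R e + t *\<^sub>R e - (t / c) *\<^sub>R x)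
        = B (proj_perp A m {k} i) (y + (- t / c) *\<^sub>R x)" for y i
      using False B_commute[of "m i" e]
      by (simp add: perp B_simps c[symmetric] field_simps)
    then have "sgn_B A m J (y - B e y *\<^sub>R e + t *\<^sub>R e - (t / c) *\<^sub>R x)
        = sgn_B A (proj_perp A m {k}) J (y + (- t / c) *\<^sub>R x)" for y
      by (simp add: sgn_B_def)
    then show "(LINT y|gauss A. h (y - B e y *\<^sub>R e + t *\<^sub>R e))
        = (sgn (t + s * c) - sgn t) * H (- t / c)"
      using e1 by (simp add: h_def B_simps H_def gen_erf_eq_gauss)
  qed
  also have "\<dots> = (LINT t|lborel. exp (- pi * t\<^sup>2) * ((sgn (t + s * c) - sgn t) * H (- t / c)))"
    unfolding gauss_real_def by (subst integral_density) auto
  also have "\<dots> = \<bar>- c\<bar> *\<^sub>R (LINT u|lborel. exp (- pi * (0 + - c * u)\<^sup>2)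
      * ((sgn (0 + - c * u + s * c) - sgn (0 + - c * u)) * H (- (0 + - c * u) / c)))"
    by (rule lborel_integral_real_affine) (use False in simp)
  also have "\<dots> = (LINT u|lborel. exp (- pi * c\<^sup>2 * u\<^sup>2) * (c * (sgn (s - u) + sgn u)) * H u)"
  proof -
    have *: "\<bar>- c\<bar> * (exp (- pi * (0 + - c * u)\<^sup>2)
        * ((sgn (0 + - c * u + s * c) - sgn (0 + - c * u)) * H (- (0 + - c * u) / c)))
      = exp (- pi * c\<^sup>2 * u\<^sup>2) * (c * (sgn (s - u) + sgn u)) * H u" for u
    proof -
      define D where "D = sgn (0 + - c * u + s * c) - sgn (0 + - c * u)"
      have "0 + - c * u + s * c = c * (s - u)" "0 + - c * u = c * (- u)"
        by (simp_all add: algebra_simps)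
      then have "D = sgn c * (sgn (s - u) + sgn u)"
        unfolding D_def by (simp only: sgn_mult) (simp add: algebra_simps)
      then have D: "c * (sgn (s - u) + sgn u) = \<bar>c\<bar> * D" by (simp add: sgn_if)
      have "- (0 + - c * u) / c = u" "- pi * (0 + - c * u)\<^sup>2 = - pi * c\<^sup>2 * u\<^sup>2"
        using False by (simp_all add: power_mult_distrib)
      then show ?thesis unfolding D D_def[symmetric] by (simp only: abs_minus_cancel mult_ac)
    qed
    show ?thesis unfolding real_scaleR_def integral_mult_right_zero[symmetric] * ..
  qed
  also have "\<dots> = (LINT u:{0..s}|lborel. 2 * c * exp (- pi * c\<^sup>2 * u\<^sup>2) * H u)"
    unfolding set_lebesgue_integral_def
  proof (rule integral_cong_AE)
    have "AE u in lborel. u \<noteq> 0" "AE u in lborel. u \<noteq> s" by (auto simp: AE_lborel_singleton)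
    then show "AE u in lborel. exp (- pi * c\<^sup>2 * u\<^sup>2) * (c * (sgn (s - u) + sgn u)) * H u
        = indicator {0..s} u *\<^sub>R (2 * c * exp (- pi * c\<^sup>2 * u\<^sup>2) * H u)"
      by eventually_elim (use s in \<open>auto simp: sgn_if indicator_def\<close>)
  qed auto
  also have "\<dots> = integral {0..s} (\<lambda>u. 2 * c * exp (- pi * c\<^sup>2 * u\<^sup>2) * H u)"
  proof (rule set_borel_integral_eq_integral(2))
    show "set_integrable lborel {0..s} (\<lambda>u. 2 * c * exp (- pi * c\<^sup>2 * u\<^sup>2) * H u)"
      unfolding set_integrable_def
    proof (rule Bochner_Integration.integrable_bound)
      show "integrable lborel (\<lambda>u. indicator {0..s} u *\<^sub>R (2 * \<bar>c\<bar>))"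
        by (auto simp: integrable_indicator_iff emeasure_lborel_Icc_eq)
      have "2 * \<bar>c\<bar> * exp (- pi * c\<^sup>2 * u\<^sup>2) * \<bar>H u\<bar> \<le> 2 * \<bar>c\<bar> * 1 * 1" for u
        by (intro mult_mono H_le) auto
      then show "AE u in lborel. norm (indicator {0..s} u *\<^sub>R (2 * c * exp (- pi * c\<^sup>2 * u\<^sup>2) * H u))
          \<le> norm (indicator {0..s} u *\<^sub>R (2 * \<bar>c\<bar>))"
        by (auto simp: indicator_def abs_mult mult_ac)
    qed auto
  qed
  finally show ?thesis by (simp add: H_def)
qed

text \<open>The increment of the error function along a ray is the sum of the mean jumps. It is the integrated
form of the formula for the derivative of \<open>s \<mapsto> gen_erf A m I (s *\<^sub>R x)\<close>.\<close>
theorem gen_erf_recursion: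
  assumes I: "finite I" and m: "nonparallel_family m I" and s: "0 \<le> s"
  shows "gen_erf A m I (s *\<^sub>R x) = gen_erf A m I 0 +
    (\<Sum>k\<in>I. integral {0..s} (\<lambda>u. 2 * coord m x k * exp (- pi * (coord m x k)\<^sup>2 * u\<^sup>2)
        * gen_erf A (proj_perp A m {k}) (I - {k}) (u *\<^sub>R x)))"
proof -
  let ?J = "\<lambda>k y. (sgn (B (m k) (y + s *\<^sub>R x)) - sgn (B (m k) y))
        * sgn_B A m (I - {k}) (y - (B (m k) y / B (m k) x) *\<^sub>R x)"
  have J_int: "integrable (gauss A) (?J k)" for k
  proof (rule integrable_gauss_bounded)
    fix y
    have "\<bar>?J k y\<bar> \<le> 2 * 1"
      unfolding abs_mult by (intro mult_mono abs_sgn_B_le) (auto simp: sgn_if)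
    then show "\<bar>?J k y\<bar> \<le> 2" by simp
  qed measurable
  have sgn_int: "integrable (gauss A) (\<lambda>y. sgn_B A m I (y + z))" for z
    by (rule integrable_gauss_bounded[OF _ abs_sgn_B_le]) measurable
  have "gen_erf A m I (s *\<^sub>R x) - gen_erf A m I 0
      = (LINT y|gauss A. sgn_B A m I (y + s *\<^sub>R x) - sgn_B A m I y)"
    unfolding gen_erf_eq_gauss using sgn_int[of "s *\<^sub>R x"] sgn_int[of 0] by simp
  also have "\<dots> = (LINT y|gauss A. (\<Sum>k\<in>I. ?J k y))"
    by (rule integral_cong_AE) (use AE_sgn_B_jumps[OF I m s, of x] in auto)
  also have "\<dots> = (\<Sum>k\<in>I. LINT y|gauss A. ?J k y)"
    by (rule Bochner_Integration.integral_sum) (rule J_int)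
  finally show ?thesis
    using m s by (simp add: jump_integral nonparallel_family_def)
qed

text \<open>Far out on the ray, each sign with \<open>B (m j) x \<noteq> 0\<close> is eventually constant for every \<open>y\<close>, while
the signs with \<open>B (m j) x = 0\<close> do not depend on \<open>s\<close>; dominated convergence does the rest.\<close>
lemma gen_erf_limit:
  fixes x :: "real^'n" and m :: "nat \<Rightarrow> real^'n"
  assumes I: "finite I"
  defines "Z \<equiv> {j\<in>I. B (m j) x = 0}"
  shows "((\<lambda>s. gen_erf A m I (s *\<^sub>R x)) \<longlongrightarrow> gen_erf A m Z 0 * sgn_B A m (I - Z) x) at_top"
proof -
  have "((\<lambda>s. LINT y|gauss A. sgn_B A m I (y + s *\<^sub>R x)) \<longlongrightarrow>
      (LINT y|gauss A. sgn_B A m Z y * sgn_B A m (I - Z) x)) at_top"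
  proof (rule integral_dominated_convergence_at_top[where w="\<lambda>_. 1"])
    show "\<forall>\<^sub>F s in at_top. AE y in gauss A. norm (sgn_B A m I (y + s *\<^sub>R x)) \<le> 1"
      by (auto simp: abs_sgn_B_le)
    have "((\<lambda>s. sgn_B A m I (y + s *\<^sub>R x)) \<longlongrightarrow> sgn_B A m Z y * sgn_B A m (I - Z) x) at_top" for y
    proof -
      have ev: "\<forall>\<^sub>F s in at_top. sgn (B (m j) y + s * B (m j) x) = sgn (B (m j) x)"
        if "B (m j) x \<noteq> 0" for j
        using eventually_gt_at_top[of "\<bar>B (m j) y\<bar> / \<bar>B (m j) x\<bar>"]
      proof eventually_elim
        case (elim s)
        then have "\<bar>B (m j) y\<bar> < s * \<bar>B (m j) x\<bar>" using that by (simp add: field_simps)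
        then show ?case using that by (auto simp: sgn_if abs_if split: if_splits)
      qed
      have "\<forall>\<^sub>F s in at_top. \<forall>j\<in>I - Z. sgn (B (m j) y + s * B (m j) x) = sgn (B (m j) x)"
        using I by (intro eventually_ball_finite) (auto simp: Z_def ev)
      then have "\<forall>\<^sub>F s in at_top. sgn_B A m I (y + s *\<^sub>R x) = sgn_B A m Z y * sgn_B A m (I - Z) x"
      proof eventually_elim
        case (elim s)
        have "sgn_B A m I (y + s *\<^sub>R x)
            = (\<Prod>j\<in>I - Z. sgn (B (m j) y + s * B (m j) x)) * (\<Prod>j\<in>Z. sgn (B (m j) y + s * B (m j) x))"
          unfolding sgn_B_def B_simps using I by (intro prod.subset_diff) (auto simp: Z_def)
        also have "(\<Prod>j\<in>Z. sgn (B (m j) y + s * B (m j) x)) = sgn_B A m Z y"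
          unfolding sgn_B_def by (rule prod.cong) (auto simp: Z_def)
        also have "(\<Prod>j\<in>I - Z. sgn (B (m j) y + s * B (m j) x)) = sgn_B A m (I - Z) x"
          unfolding sgn_B_def by (rule prod.cong) (use elim in auto)
        finally show ?case by (simp add: mult.commute)
      qed
      then show ?thesis by (rule tendsto_eventually)
    qed
    then show "AE y in gauss A. ((\<lambda>s. sgn_B A m I (y + s *\<^sub>R x)) \<longlongrightarrow>
        sgn_B A m Z y * sgn_B A m (I - Z) x) at_top" by simp
  qed auto
  then show ?thesis by (simp add: gen_erf_eq_gauss)
qed

end

section \<open>Iterated integrals\<close>

text \<open>The iterated integrals produced by iterating the recursion above, with arguments in the order of
integration from outside to inside. Up to the substitution \<open>t = u\<^sup>2\<close> they are the
integrals along the vertical line above \<open>\<tau>\<close>.\<close>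
primrec real_iter_int :: "real list \<Rightarrow> real \<Rightarrow> real" where
  "real_iter_int [] s = 1"
| "real_iter_int (b # bs) s =
     integral {0..s} (\<lambda>u. 2 * b * exp (- pi * b\<^sup>2 * u\<^sup>2) * real_iter_int bs u)"

lemma real_iter_int_fun:
  "real_iter_int [] = (\<lambda>s. 1)"
  "real_iter_int (b # bs) =
    (\<lambda>s. integral {0..s} (\<lambda>u. 2 * b * exp (- pi * b\<^sup>2 * u\<^sup>2) * real_iter_int bs u))"
  by auto

lemma continuous_on_real_iter_int: "continuous_on {0..} (real_iter_int bs)"
proof (induction bs)
  case Nil
  show ?case by simp
next
  case (Cons b bs)
  let ?f = "\<lambda>u. 2 * b * exp (- pi * b\<^sup>2 * u\<^sup>2) * real_iter_int bs u"
  have "continuous (at x within {0..}) (real_iter_int (b # bs))" if "x \<ge> 0" for x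
  proof -
    have "continuous_on {0..x+1} ?f"
      by (intro continuous_intros continuous_on_subset[OF Cons.IH]) auto
    then have "continuous_on {0..x+1} (\<lambda>s. integral {0..s} ?f)"
      by (intro indefinite_integral_continuous_1 integrable_continuous_real)
    then have "continuous (at x within {0..x+1}) (\<lambda>s. integral {0..s} ?f)"
      using that by (auto simp: continuous_on_eq_continuous_within)
    moreover have "at x within {0..} = at x within {0..x+1}"
      by (rule at_within_nhd[of x "{..<x+1}"]) auto
    ultimately show ?thesis by (simp add: continuous_within real_iter_int_fun(2))
  qed
  then show ?case
    by (auto simp: continuous_on_eq_continuous_within simp del: real_iter_int.simps)
qed

lemma continuous_on_iter_integrand:
  "continuous_on {0..} (\<lambda>u. 2 * b * exp (- pi * b\<^sup>2 * u\<^sup>2) * real_iter_int bs u)"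
  by (intro continuous_intros continuous_on_real_iter_int)

lemma iter_integrand_integrable:
  "(\<lambda>u. 2 * b * exp (- pi * b\<^sup>2 * u\<^sup>2) * real_iter_int bs u) integrable_on {0..s}"
  by (rule integrable_continuous_real, rule continuous_on_subset[OF continuous_on_iter_integrand]) auto

lemma has_real_derivative_real_iter_int:
  assumes "s > 0"
  shows "(real_iter_int (b # bs) has_real_derivative
    2 * b * exp (- pi * b\<^sup>2 * s\<^sup>2) * real_iter_int bs s) (at s)"
proof -
  let ?f = "\<lambda>u. 2 * b * exp (- pi * b\<^sup>2 * u\<^sup>2) * real_iter_int bs u"
  have "continuous_on {0..s+1} ?f"
    by (rule continuous_on_subset[OF continuous_on_iter_integrand]) auto
  then have "((\<lambda>s. integral {0..s} ?f) has_real_derivative ?f s) (at s within {0..s+1})"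
    by (rule integral_has_real_derivative) (use assms in auto)
  moreover have "at s within {0..s+1} = at s"
    by (rule at_within_Icc_at) (use assms in auto)
  ultimately show ?thesis by (simp add: real_iter_int_fun(2))
qed

text \<open>The integrand in the variable \<open>t = u\<^sup>2\<close>, where \<open>2 * du\<close> becomes \<open>dt / sqrt t\<close>.\<close>
definition sqrt_kern :: "real \<Rightarrow> real list \<Rightarrow> real \<Rightarrow> real" where
  "sqrt_kern b bs t = b * exp (- pi * b\<^sup>2 * t) / sqrt t * real_iter_int bs (sqrt t)"

text \<open>The integrand is singular at \<open>0\<close>, but \<open>real_iter_int (b # bs) (sqrt (c * x))\<close> is a primitive in the
interior that is continuous up to the end points, so the fundamental theorem of calculus still
applies. The scaling \<open>c\<close> serves both uses: \<open>c = t\<close> on \<open>{0..1}\<close> for the parametrization of a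
segment of length \<open>t\<close>, and \<open>c = 1\<close> for the integral over the half-line.\<close>
lemma has_integral_sqrt_kern:
  assumes c: "c \<ge> 0" and X: "X \<ge> 0"
  shows "((\<lambda>x. c * sqrt_kern b bs (c * x)) has_integral real_iter_int (b # bs) (sqrt (c * X))) {0..X}"
proof (cases "c = 0")
  case False
  then have c: "c > 0" using c by simp
  let ?F = "\<lambda>x. real_iter_int (b # bs) (sqrt (c * x))"
  have "((\<lambda>x. c * sqrt_kern b bs (c * x)) has_integral (?F X - ?F 0)) {0..X}"
  proof (rule fundamental_theorem_of_calculus_interior[OF X])
    show "continuous_on {0..X} ?F"
      by (rule continuous_on_compose2[OF continuous_on_real_iter_int])
        (use c in \<open>auto intro!: continuous_intros\<close>)
    fix x assume "x \<in> {0<..<X}"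
    then have x: "c * x > 0" using c by simp
    have "((\<lambda>x. sqrt (c * x)) has_real_derivative inverse (sqrt (c * x)) / 2 * c) (at x)"
      using x by (auto intro!: derivative_eq_intros)
    from DERIV_chain2[OF has_real_derivative_real_iter_int this, of b bs] x
    have "(?F has_real_derivative 2 * b * exp (- pi * b\<^sup>2 * (sqrt (c * x))\<^sup>2)
        * real_iter_int bs (sqrt (c * x)) * (inverse (sqrt (c * x)) / 2 * c)) (at x)"
      by simp
    also have "2 * b * exp (- pi * b\<^sup>2 * (sqrt (c * x))\<^sup>2)
        * real_iter_int bs (sqrt (c * x)) * (inverse (sqrt (c * x)) / 2 * c) = c * sqrt_kern b bs (c * x)"
      using x by (simp add: sqrt_kern_def field_simps)
    finally show "(?F has_vector_derivative c * sqrt_kern b bs (c * x)) (at x)"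
      by (simp add: has_real_derivative_iff_has_vector_derivative)
  qed
  then show ?thesis by simp
qed simp

text \<open>On the vertical line, \<open>\<i> * (w - \<tau>) = - t\<close> has argument \<open>pi\<close>, so its principal root is
\<open>\<i> * sqrt t\<close>; the factor \<open>\<i>\<close> is cancelled by the one in \<open>dw = \<i> * dt\<close>. For \<open>t = 0\<close> both sides are
\<open>0\<close> by the convention for division.\<close>
lemma kern_upward:
  assumes "t \<ge> 0"
  shows "kern \<tau> b (\<tau> + \<i> * of_real t) * \<i> = of_real (b * exp (- pi * b\<^sup>2 * t) / sqrt t)"
proof -
  have "csqrt (\<i> * (\<i> * of_real t)) = \<i> * of_real (sqrt t)"
    using assms by (subst csqrt_of_real_nonpos) (auto simp flip: mult.assoc)
  moreover have "of_real pi * \<i> * (of_real b)\<^sup>2 * (\<i> * of_real t) = of_real (- pi * b\<^sup>2 * t)"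
    by (simp add: algebra_simps)
  ultimately show ?thesis
    by (simp only: kern_def add_diff_cancel_left' exp_of_real) simp
qed

lemma inner_iter_int_upward:
  assumes "t \<ge> 0"
  shows "inner_iter_int \<tau> bs (\<tau> + \<i> * of_real t) = of_real (real_iter_int bs (sqrt t))"
  using assms
proof (induction bs arbitrary: t)
  case (Cons b bs)
  let ?f = "\<lambda>w. kern \<tau> b w * inner_iter_int \<tau> bs w"
  have "((\<lambda>x. of_real (t * sqrt_kern b bs (t * x))) has_integral
      complex_of_real (real_iter_int (b # bs) (sqrt t))) {0..1}"
    using has_integral_of_real[OF has_integral_sqrt_kern[OF Cons.prems, of 1 b bs]]
    by (simp del: real_iter_int.simps of_real_mult)
  moreover have "of_real (t * sqrt_kern b bs (t * x))
      = ?f (linepath \<tau> (\<tau> + \<i> * of_real t) x) * (\<tau> + \<i> * of_real t - \<tau>)" if x: "x \<in> {0..1}" for x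
  proof -
    have tx: "t * x \<ge> 0" using x Cons.prems by simp
    have path: "linepath \<tau> (\<tau> + \<i> * of_real t) x = \<tau> + \<i> * of_real (t * x)"
      by (simp add: linepath_def algebra_simps scaleR_conv_of_real)
    have "?f (\<tau> + \<i> * of_real (t * x)) * (\<tau> + \<i> * of_real t - \<tau>)
        = (kern \<tau> b (\<tau> + \<i> * of_real (t * x)) * \<i>) * inner_iter_int \<tau> bs (\<tau> + \<i> * of_real (t * x)) * of_real t"
      by (simp add: mult_ac)
    also have "\<dots> = of_real (t * sqrt_kern b bs (t * x))"
      unfolding kern_upward[OF tx] Cons.IH[OF tx] by (simp add: sqrt_kern_def)
    finally show ?thesis unfolding path by (rule sym)
  qed
  ultimately have "(?f has_contour_integral of_real (real_iter_int (b # bs) (sqrt t)))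
      (linepath \<tau> (\<tau> + \<i> * of_real t))"
    unfolding has_contour_integral_linepath by (rule has_integral_eq[rotated])
  then show ?case by (simp add: contour_integral_unique del: real_iter_int.simps)
qed simp

lemma set_integrable_iter_integrand:
  assumes "\<And>u. u \<ge> 0 \<Longrightarrow> \<bar>real_iter_int bs u\<bar> \<le> C"
  shows "set_integrable lborel {0..} (\<lambda>u. 2 * b * exp (- pi * b\<^sup>2 * u\<^sup>2) * real_iter_int bs u)"
  unfolding set_integrable_def
proof (rule Bochner_Integration.integrable_bound)
  have "integrable lborel (\<lambda>u. exp (- pi * (b\<^sup>2 * u\<^sup>2)))" if "b \<noteq> 0"
    using that nn_integral_gaussian_real[of "b\<^sup>2"] by (intro integrableI_nonneg) auto
  then show "integrable lborel (\<lambda>u. 2 * \<bar>b\<bar> * exp (- pi * (b\<^sup>2 * u\<^sup>2)) * C)"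
    by (cases "b = 0") auto
  show "(\<lambda>u. indicator {0..} u *\<^sub>R (2 * b * exp (- pi * b\<^sup>2 * u\<^sup>2) * real_iter_int bs u))
      \<in> borel_measurable lborel"
    using borel_measurable_continuous_on_indicator[OF _ continuous_on_iter_integrand, of b bs] by simp
  have "2 * \<bar>b\<bar> * exp (- pi * b\<^sup>2 * u\<^sup>2) * \<bar>real_iter_int bs u\<bar>
      \<le> \<bar>2 * \<bar>b\<bar> * exp (- pi * (b\<^sup>2 * u\<^sup>2)) * C\<bar>" if "u \<ge> 0" for u
    unfolding abs_mult using assms[OF that] by (intro mult_mono) (auto simp: mult.assoc)
  then show "AE u in lborel. norm (indicator {0..} u *\<^sub>R (2 * b * exp (- pi * b\<^sup>2 * u\<^sup>2) * real_iter_int bs u))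
      \<le> norm (2 * \<bar>b\<bar> * exp (- pi * (b\<^sup>2 * u\<^sup>2)) * C)"
    by (auto simp: indicator_def abs_mult)
qed

lemma real_iter_int_set_integral:
  assumes "set_integrable lborel {0..} (\<lambda>u. 2 * b * exp (- pi * b\<^sup>2 * u\<^sup>2) * real_iter_int bs u)"
  shows "real_iter_int (b # bs) s
    = (LINT u:{0..s}|lborel. 2 * b * exp (- pi * b\<^sup>2 * u\<^sup>2) * real_iter_int bs u)"
  using set_borel_integral_eq_integral(2)[OF set_integrable_subset[OF assms, of "{0..s}"]] by simp

lemma real_iter_int_bounded: "\<exists>C. \<forall>s\<ge>0. \<bar>real_iter_int bs s\<bar> \<le> C"
proof (induction bs)
  case Nil
  show ?case by (rule exI[of _ 1]) simp
next
  case (Cons b bs)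
  let ?f = "\<lambda>u. 2 * b * exp (- pi * b\<^sup>2 * u\<^sup>2) * real_iter_int bs u"
  have int: "set_integrable lborel {0..} ?f"
    using Cons.IH set_integrable_iter_integrand by blast
  have "\<bar>real_iter_int (b # bs) s\<bar> \<le> (LINT u:{0..}|lborel. \<bar>?f u\<bar>)" for s
  proof -
    have "\<bar>LINT u:{0..s}|lborel. ?f u\<bar> \<le> (LINT u|lborel. \<bar>indicator {0..s} u *\<^sub>R ?f u\<bar>)"
      unfolding set_lebesgue_integral_def by (rule integral_abs_bound)
    also have "\<dots> \<le> (LINT u:{0..}|lborel. \<bar>?f u\<bar>)"
      unfolding set_lebesgue_integral_def
    proof (rule integral_mono)
      show "integrable lborel (\<lambda>u. \<bar>indicator {0..s} u *\<^sub>R ?f u\<bar>)"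
        using set_integrable_subset[OF int, of "{0..s}"] unfolding set_integrable_def
        by (intro integrable_abs) auto
      show "integrable lborel (\<lambda>u. indicator {0..} u *\<^sub>R \<bar>?f u\<bar>)"
        using set_integrable_abs[OF int] unfolding set_integrable_def .
    qed (auto simp: indicator_def)
    finally show ?thesis unfolding real_iter_int_set_integral[OF int] .
  qed
  then show ?case by blast
qed

lemma real_iter_int_convergent: "\<exists>L. (real_iter_int bs \<longlongrightarrow> L) at_top"
proof (cases bs)
  case Nil
  show ?thesis unfolding Nil real_iter_int_fun(1) by auto
next
  case (Cons b bs')
  obtain C where "\<And>u. u \<ge> 0 \<Longrightarrow> \<bar>real_iter_int bs' u\<bar> \<le> C" using real_iter_int_bounded by blast
  then have int: "set_integrable lborel {0..} (\<lambda>u. 2 * b * exp (- pi * b\<^sup>2 * u\<^sup>2) * real_iter_int bs' u)"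
    by (rule set_integrable_iter_integrand)
  from tendsto_set_lebesgue_integral_at_top[OF _ this]
  show ?thesis unfolding Cons real_iter_int_set_integral[OF int, abs_def] by auto
qed

text \<open>All integrands have constant sign, which gives access to monotone convergence for the integral over
the half-line.\<close>
lemma real_iter_int_sign: "\<exists>\<epsilon>\<in>{1, -1}. \<forall>s\<ge>0. 0 \<le> \<epsilon> * real_iter_int bs s"
proof (induction bs)
  case Nil
  show ?case by simp
next
  case (Cons b bs)
  then obtain \<epsilon> where \<epsilon>: "\<epsilon> \<in> {1, -1}" "\<And>s. s \<ge> 0 \<Longrightarrow> 0 \<le> \<epsilon> * real_iter_int bs s" by blast
  define \<delta> where "\<delta> = (if b < 0 then - \<epsilon> else \<epsilon>)"
  have "0 \<le> \<delta> * real_iter_int (b # bs) s" if "s \<ge> 0" for s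
  proof -
    let ?f = "\<lambda>u. 2 * b * exp (- pi * b\<^sup>2 * u\<^sup>2) * real_iter_int bs u"
    have "0 \<le> integral {0..s} (\<lambda>u. \<delta> * ?f u)"
    proof (rule Henstock_Kurzweil_Integration.integral_nonneg)
      show "(\<lambda>u. \<delta> * ?f u) integrable_on {0..s}"
        by (rule integrable_on_mult_right[OF iter_integrand_integrable])
      fix u assume u: "u \<in> {0..s}"
      have "\<delta> * ?f u = 2 * \<bar>b\<bar> * exp (- pi * b\<^sup>2 * u\<^sup>2) * (\<epsilon> * real_iter_int bs u)"
        by (simp add: \<delta>_def)
      also have "\<dots> \<ge> 0" by (rule mult_nonneg_nonneg) (use \<epsilon>(2)[of u] u in auto)
      finally show "0 \<le> \<delta> * ?f u" .
    qed
    then show ?thesis unfolding real_iter_int.simps integral_mult_right .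
  qed
  moreover have "\<delta> \<in> {1, -1}" using \<epsilon>(1) by (auto simp: \<delta>_def)
  ultimately show ?case by blast
qed

lemma iter_int_eq_limit:
  assumes L: "(real_iter_int bs \<longlongrightarrow> L) at_top"
  shows "iter_int \<tau> bs = of_real L"
proof (cases bs)
  case Nil
  then have "L = 1" using L by (simp add: real_iter_int_fun(1) tendsto_const_iff)
  then show ?thesis using Nil by simp
next
  case (Cons b bs')
  obtain \<epsilon>' where \<epsilon>': "\<epsilon>' \<in> {1, -1}" "\<And>s. s \<ge> 0 \<Longrightarrow> 0 \<le> \<epsilon>' * real_iter_int bs' s"
    using real_iter_int_sign[of bs'] by blast
  define \<epsilon> where "\<epsilon> = (if b < 0 then - \<epsilon>' else \<epsilon>')"
  have \<epsilon>\<epsilon>: "\<epsilon> * \<epsilon> = 1" using \<epsilon>'(1) by (auto simp: \<epsilon>_def)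
  let ?h = "sqrt_kern b bs'"
  have h: "(?h has_integral real_iter_int bs (sqrt y)) {0..y}" if "y \<ge> 0" for y
    using has_integral_sqrt_kern[of 1 y b bs'] that Cons by simp
  have "((\<lambda>t. \<epsilon> * ?h t) has_integral \<epsilon> * L) {0..}"
  proof (rule has_integral_to_inf)
    show "(\<lambda>t. \<epsilon> * ?h t) integrable_on {0..y}" for y
      using integrable_on_mult_right[OF has_integral_integrable[OF h[of y]]] by (cases "y \<ge> 0") auto
    have "((\<lambda>y. \<epsilon> * real_iter_int bs (sqrt y)) \<longlongrightarrow> \<epsilon> * L) at_top"
      by (intro tendsto_intros filterlim_compose[OF L sqrt_at_top])
    moreover have "\<forall>\<^sub>F y in at_top. \<epsilon> * real_iter_int bs (sqrt y) = integral {0..y} (\<lambda>t. \<epsilon> * ?h t)"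
      using eventually_ge_at_top[of 0]
      by eventually_elim (simp add: integral_unique[OF h])
    ultimately show "((\<lambda>y. integral {0..y} (\<lambda>t. \<epsilon> * ?h t)) \<longlongrightarrow> \<epsilon> * L) at_top"
      by (rule Lim_transform_eventually)
    fix t :: real assume "t \<ge> 0"
    have "\<epsilon> * ?h t = \<bar>b\<bar> * exp (- pi * b\<^sup>2 * t) / sqrt t * (\<epsilon>' * real_iter_int bs' (sqrt t))"
      by (simp add: sqrt_kern_def \<epsilon>_def)
    also have "\<dots> \<ge> 0" by (rule mult_nonneg_nonneg) (use \<epsilon>'(2)[of "sqrt t"] \<open>t \<ge> 0\<close> in auto)
    finally show "\<epsilon> * ?h t \<ge> 0" .
  qed
  then have "((\<lambda>t. \<epsilon> * (\<epsilon> * ?h t)) has_integral \<epsilon> * (\<epsilon> * L)) {0..}"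
    by (rule has_integral_mult_right)
  then have "(?h has_integral L) {0..}" using \<epsilon>\<epsilon> by (simp flip: mult.assoc)
  then have "((\<lambda>t. of_real (?h t)) has_integral complex_of_real L) {0..}"
    by (rule has_integral_of_real)
  moreover have "of_real (?h t) = kern \<tau> b (\<tau> + \<i> * of_real t)
      * inner_iter_int \<tau> bs' (\<tau> + \<i> * of_real t) * \<i>" if "t \<in> {0..}" for t
  proof -
    have t: "t \<ge> 0" using that by simp
    have "kern \<tau> b (\<tau> + \<i> * of_real t) * inner_iter_int \<tau> bs' (\<tau> + \<i> * of_real t) * \<i>
        = (kern \<tau> b (\<tau> + \<i> * of_real t) * \<i>) * inner_iter_int \<tau> bs' (\<tau> + \<i> * of_real t)"
      by (simp add: mult_ac)
    then show ?thesis
      unfolding kern_upward[OF t] inner_iter_int_upward[OF t] by (simp add: sqrt_kern_def)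
  qed
  ultimately have "((\<lambda>t. kern \<tau> b (\<tau> + \<i> * of_real t)
      * inner_iter_int \<tau> bs' (\<tau> + \<i> * of_real t) * \<i>) has_integral complex_of_real L) {0..}"
    by (rule has_integral_eq[rotated])
  then show ?thesis
    unfolding Cons iter_int.simps upward_integral_def by (rule integral_unique)
qed

section \<open>Permutations and sequences of distinct indices\<close>

definition distinct_lists :: "'a set \<Rightarrow> 'a list set" where
  "distinct_lists I = {ks. distinct ks \<and> set ks \<subseteq> I}"

lemma finite_distinct_lists: "finite I \<Longrightarrow> finite (distinct_lists I)"
  using finite_subset_distinct[of I] by (simp add: distinct_lists_def conj_commute)

text \<open>Splitting a sum over sequences of distinct indices according to their first entry, as required by
the recursion for the error function.\<close>
lemma sum_distinct_lists:
  fixes f :: "'a list \<Rightarrow> real"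
  assumes "finite I"
  shows "(\<Sum>ks\<in>distinct_lists I. f ks)
    = f [] + (\<Sum>k\<in>I. \<Sum>ks\<in>distinct_lists (I - {k}). f (k # ks))"
proof -
  have "distinct_lists I = insert [] (\<Union>k\<in>I. (#) k ` distinct_lists (I - {k}))"
  proof (intro set_eqI)
    fix ks
    show "ks \<in> distinct_lists I \<longleftrightarrow> ks \<in> insert [] (\<Union>k\<in>I. (#) k ` distinct_lists (I - {k}))"
      by (cases ks) (auto simp: distinct_lists_def)
  qed
  then have "(\<Sum>ks\<in>distinct_lists I. f ks)
      = f [] + (\<Sum>ks\<in>(\<Union>k\<in>I. (#) k ` distinct_lists (I - {k})). f ks)"
    using assms by (simp, subst sum.insert) (auto simp: finite_distinct_lists)
  also have "(\<Sum>ks\<in>(\<Union>k\<in>I. (#) k ` distinct_lists (I - {k})). f ks)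
      = (\<Sum>k\<in>I. \<Sum>ks\<in>(#) k ` distinct_lists (I - {k}). f ks)"
    by (rule sum.UNION_disjoint) (use assms in \<open>auto simp: finite_distinct_lists\<close>)
  also have "\<dots> = (\<Sum>k\<in>I. \<Sum>ks\<in>distinct_lists (I - {k}). f (k # ks))"
    by (simp add: sum.reindex inj_on_def)
  finally show ?thesis .
qed

text \<open>This count explains the factor \<open>1 / (r - l)!\<close>: the summand of \<open>\<sigma>\<close> and \<open>l\<close> depends only on the first
\<open>l\<close> values of \<open>\<sigma>\<close>. Given one permutation \<open>\<rho>\<close> with these values, all others arise by composing it
with a permutation of the last \<open>r - l\<close> positions.\<close>
lemma card_permutations_with_prefix:
  assumes ks: "distinct ks" "set ks \<subseteq> {1..r}" and l: "length ks = l"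
  shows "card {\<sigma>. \<sigma> permutes {1..r} \<and> map \<sigma> [1..<Suc l] = ks} = fact (r - l)"
proof -
  have "l \<le> r" using card_mono[OF _ ks(2)] distinct_card[OF ks(1)] l by simp
  have "card ({1..r} - set ks) = card {l+1..r}"
    using ks l \<open>l \<le> r\<close> by (simp add: card_Diff_subset distinct_card)
  then obtain g where g: "bij_betw g {l+1..r} ({1..r} - set ks)"
    using finite_same_card_bij[of "{l+1..r}" "{1..r} - set ks"] by auto
  define \<rho> where "\<rho> i = (if i \<in> {1..l} then ks ! (i - 1) else if i \<in> {l+1..r} then g i else i)" for i
  have "bij_betw (\<lambda>i. ks ! (i - 1)) {1..l} (set ks)"
  proof (rule bij_betw_imageI)
    show "inj_on (\<lambda>i. ks ! (i - 1)) {1..l}"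
      using ks(1) l by (auto simp: inj_on_def nth_eq_iff_index_eq)
    have "{1..l} = Suc ` {..<l}" by (simp add: image_Suc_lessThan)
    then show "(\<lambda>i. ks ! (i - 1)) ` {1..l} = set ks"
      using l by (auto simp: image_image in_set_conv_nth image_iff)
  qed
  then have "bij_betw \<rho> {1..l} (set ks)" by (rule bij_betw_cong[THEN iffD1, rotated]) (simp add: \<rho>_def)
  moreover have "bij_betw \<rho> {l+1..r} ({1..r} - set ks)"
    using g by (rule bij_betw_cong[THEN iffD1, rotated]) (simp add: \<rho>_def)
  ultimately have "bij_betw \<rho> ({1..l} \<union> {l+1..r}) (set ks \<union> ({1..r} - set ks))"
    by (rule bij_betw_combine) auto
  moreover have "{1..l} \<union> {l+1..r} = {1..r}" "set ks \<union> ({1..r} - set ks) = {1..r}"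
    using \<open>l \<le> r\<close> ks(2) by auto
  ultimately have \<rho>: "\<rho> permutes {1..r}"
    by (intro bij_imp_permutes) (auto simp: \<rho>_def)
  have pre: "map \<sigma> [1..<Suc l] = ks \<longleftrightarrow> (\<forall>i\<in>{1..l}. \<sigma> i = \<rho> i)" for \<sigma>
  proof -
    have "map \<rho> [1..<Suc l] = ks"
      using l by (intro nth_equalityI) (auto simp: \<rho>_def simp del: upt_Suc)
    then have "map \<sigma> [1..<Suc l] = ks \<longleftrightarrow> map \<sigma> [1..<Suc l] = map \<rho> [1..<Suc l]" by simp
    also have "\<dots> \<longleftrightarrow> (\<forall>i\<in>{1..l}. \<sigma> i = \<rho> i)" unfolding map_eq_conv by auto
    finally show ?thesis .
  qed
  have "{\<sigma>. \<sigma> permutes {1..r} \<and> map \<sigma> [1..<Suc l] = ks} = (\<circ>) \<rho> ` {\<pi>. \<pi> permutes {l+1..r}}"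
  proof (intro equalityI subsetI)
    fix \<sigma> assume "\<sigma> \<in> {\<sigma>. \<sigma> permutes {1..r} \<and> map \<sigma> [1..<Suc l] = ks}"
    then have \<sigma>: "\<sigma> permutes {1..r}" "\<And>i. i \<in> {1..l} \<Longrightarrow> \<sigma> i = \<rho> i" 
      using pre[of \<sigma>] by blast+
    have "inv \<rho> \<circ> \<sigma> permutes {1..r}" by (intro permutes_compose \<sigma> permutes_inv \<rho>)
    moreover have "(inv \<rho> \<circ> \<sigma>) i = i" if "i \<in> {1..r} - {l+1..r}" for i
    proof -
      have "i \<in> {1..l}" using that by auto
      then show ?thesis using \<sigma>(2)[of i] permutes_inverses(2)[OF \<rho>] by simp
    qed
    ultimately have "inv \<rho> \<circ> \<sigma> permutes {l+1..r}"
      by (rule permutes_superset)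
    moreover have "\<sigma> = \<rho> \<circ> (inv \<rho> \<circ> \<sigma>)" by (simp add: fun_eq_iff permutes_inverses(1)[OF \<rho>])
    ultimately show "\<sigma> \<in> (\<circ>) \<rho> ` {\<pi>. \<pi> permutes {l+1..r}}" by blast
  next
    fix \<sigma> assume "\<sigma> \<in> (\<circ>) \<rho> ` {\<pi>. \<pi> permutes {l+1..r}}"
    then obtain \<pi> where \<pi>: "\<pi> permutes {l+1..r}" "\<sigma> = \<rho> \<circ> \<pi>" by auto
    have "\<pi> permutes {1..r}" by (rule permutes_subset[OF \<pi>(1)]) auto
    then have "\<sigma> permutes {1..r}" unfolding \<pi>(2) using \<rho> by (rule permutes_compose)
    moreover have "\<sigma> i = \<rho> i" if "i \<in> {1..l}" for i
      using permutes_not_in[OF \<pi>(1), of i] that by (simp add: \<pi>(2))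
    ultimately show "\<sigma> \<in> {\<sigma>. \<sigma> permutes {1..r} \<and> map \<sigma> [1..<Suc l] = ks}"
      unfolding mem_Collect_eq pre by blast
  qed
  moreover have "inj_on ((\<circ>) \<rho>) {\<pi>. \<pi> permutes {l+1..r}}"
    using permutes_inj[OF \<rho>] by (auto simp: inj_on_def fun_eq_iff dest: injD)
  ultimately show ?thesis
    using card_permutations[of "{l+1..r}" "r - l"] by (simp add: card_image del: upt_Suc)
qed

lemma sum_permutations_eq_distinct_lists:
  fixes f :: "nat list \<Rightarrow> complex"
  shows "(\<Sum>\<sigma> | \<sigma> permutes {1..r}. \<Sum>l = 0..r. f (map \<sigma> [1..<Suc l]) / fact (r - l))
    = (\<Sum>ks\<in>distinct_lists {1..r}. f ks)"
proof -
  let ?D = "\<lambda>l. {ks \<in> distinct_lists {1..r}. length ks = l}"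
  have fin: "finite (distinct_lists {1..r::nat})" by (rule finite_distinct_lists) simp
  have one: "(\<Sum>\<sigma> | \<sigma> permutes {1..r}. f (map \<sigma> [1..<Suc l]) / fact (r - l)) = (\<Sum>ks\<in>?D l. f ks)"
    if "l \<in> {0..r}" for l
  proof -
    have "(\<Sum>\<sigma> | \<sigma> permutes {1..r}. f (map \<sigma> [1..<Suc l]) / fact (r - l))
        = (\<Sum>ks\<in>?D l. \<Sum>\<sigma> | \<sigma> \<in> {\<sigma>. \<sigma> permutes {1..r}} \<and> map \<sigma> [1..<Suc l] = ks.
            f (map \<sigma> [1..<Suc l]) / fact (r - l))"
    proof (rule sum.group[symmetric])
      show "(\<lambda>\<sigma>. map \<sigma> [1..<Suc l]) ` {\<sigma>. \<sigma> permutes {1..r}} \<subseteq> ?D l"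
      proof
        fix ks assume "ks \<in> (\<lambda>\<sigma>. map \<sigma> [1..<Suc l]) ` {\<sigma>. \<sigma> permutes {1..r}}"
        then obtain \<sigma> where \<sigma>: "\<sigma> permutes {1..r}" "ks = map \<sigma> [1..<Suc l]" by auto
        have "inj_on \<sigma> (set [1..<Suc l])" using permutes_inj[OF \<sigma>(1)] inj_on_subset by blast
        moreover have "\<sigma> i \<in> {1..r}" if "i \<in> {1..<Suc l}" for i
          using permutes_in_image[OF \<sigma>(1), of i] that \<open>l \<in> {0..r}\<close> by auto
        ultimately show "ks \<in> ?D l"
          unfolding \<sigma>(2) distinct_lists_def by (auto simp: distinct_map simp del: upt_Suc)
      qed
    qed (use fin in \<open>auto simp: finite_permutations\<close>)
    also have "\<dots> = (\<Sum>ks\<in>?D l. f ks)"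
    proof (rule sum.cong[OF refl])
      fix ks assume ks: "ks \<in> ?D l"
      have "(\<Sum>\<sigma> | \<sigma> \<in> {\<sigma>. \<sigma> permutes {1..r}} \<and> map \<sigma> [1..<Suc l] = ks.
            f (map \<sigma> [1..<Suc l]) / fact (r - l))
          = (\<Sum>\<sigma> | \<sigma> permutes {1..r} \<and> map \<sigma> [1..<Suc l] = ks. f ks / fact (r - l))"
        by (rule sum.cong) auto
      also have "\<dots> = f ks"
        using card_permutations_with_prefix[of ks r l] ks
        by (simp add: distinct_lists_def del: upt_Suc)
      finally show "(\<Sum>\<sigma> | \<sigma> \<in> {\<sigma>. \<sigma> permutes {1..r}} \<and> map \<sigma> [1..<Suc l] = ks.
            f (map \<sigma> [1..<Suc l]) / fact (r - l)) = f ks" .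
    qed
    finally show ?thesis .
  qed
  have "(\<Sum>\<sigma> | \<sigma> permutes {1..r}. \<Sum>l = 0..r. f (map \<sigma> [1..<Suc l]) / fact (r - l))
      = (\<Sum>l = 0..r. \<Sum>ks\<in>?D l. f ks)"
    by (subst sum.swap) (rule sum.cong[OF refl one])
  also have "\<dots> = (\<Sum>ks\<in>distinct_lists {1..r}. f ks)"
  proof (rule sum.group[OF fin])
    show "length ` distinct_lists {1..r} \<subseteq> {0..r}"
    proof clarify
      fix ks :: "nat list" assume "ks \<in> distinct_lists {1..r}"
      then show "length ks \<in> {0..r}"
        using card_mono[of "{1..r}" "set ks"] by (auto simp: distinct_lists_def distinct_card)
    qed
  qed simp
  finally show ?thesis .
qed


section \<open>Expansion of the error function\<close>

context pos_def_form
begin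

text \<open>The coordinates of \<open>x\<close> that accumulate when the vectors with indices \<open>k # ks\<close> are removed in turn,
starting from the family that is already projected away from \<open>S\<close>.\<close>
fun perp_coords :: "(nat \<Rightarrow> real^'n) \<Rightarrow> real^'n \<Rightarrow> nat set \<Rightarrow> nat list \<Rightarrow> real list" where
  "perp_coords m x S [] = []"
| "perp_coords m x S (k # ks) = coord (proj_perp A m S) x k # perp_coords m x (insert k S) ks"

lemma nonparallel_proj_perp:
  assumes "lin_indep_family m (S \<union> I)" "finite (S \<union> I)" "S \<inter> I = {}"
  shows "nonparallel_family (proj_perp A m S) I"
  unfolding nonparallel_family_def
proof (intro conjI ballI allI impI)
  fix k assume "k \<in> I"
  then show "proj_perp A m S k \<noteq> 0"
    using assms by (intro proj_perp_nonzero[of m "S \<union> I"]) auto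
next
  fix k l a b
  assume "k \<in> I" "l \<in> I" "k \<noteq> l" "a *\<^sub>R proj_perp A m S k = b *\<^sub>R proj_perp A m S l"
  then show "a = 0"
    using assms by (intro proj_perp_nonparallel[of m "S \<union> I" S k l a b]) auto
qed

text \<open>Iterating the recursion until no index is left. The set \<open>S\<close> of indices already removed is kept
general so that the induction hypothesis applies to the projected families.\<close>
lemma gen_erf_expansion:
  assumes "lin_indep_family m (S \<union> I)" "finite (S \<union> I)" "S \<inter> I = {}" "0 \<le> s"
  shows "gen_erf A (proj_perp A m S) I (s *\<^sub>R x) =
    (\<Sum>ks\<in>distinct_lists I. gen_erf A (proj_perp A m (S \<union> set ks)) (I - set ks) 0
      * real_iter_int (perp_coords m x S ks) s)"
  using assms
proof (induction "card I" arbitrary: S I s rule: less_induct)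
  case less
  let ?m = "proj_perp A m S"
  let ?E = "\<lambda>ks. gen_erf A (proj_perp A m (S \<union> set ks)) (I - set ks) 0"
  have fin: "finite S" "finite I" using less.prems by auto
  have "gen_erf A ?m I (s *\<^sub>R x) = gen_erf A ?m I 0 +
    (\<Sum>k\<in>I. integral {0..s} (\<lambda>u. 2 * coord ?m x k * exp (- pi * (coord ?m x k)\<^sup>2 * u\<^sup>2)
        * gen_erf A (proj_perp A ?m {k}) (I - {k}) (u *\<^sub>R x)))"
    by (rule gen_erf_recursion[OF fin(2) nonparallel_proj_perp]) (use less.prems in auto)
  also have "(\<Sum>k\<in>I. integral {0..s} (\<lambda>u. 2 * coord ?m x k * exp (- pi * (coord ?m x k)\<^sup>2 * u\<^sup>2)
        * gen_erf A (proj_perp A ?m {k}) (I - {k}) (u *\<^sub>R x)))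
    = (\<Sum>k\<in>I. \<Sum>ks\<in>distinct_lists (I - {k}). ?E (k # ks) * real_iter_int (perp_coords m x S (k # ks)) s)"
  proof (rule sum.cong[OF refl])
    fix k assume k: "k \<in> I"
    let ?c = "coord ?m x k"
    let ?g = "\<lambda>ks u. 2 * ?c * exp (- pi * ?c\<^sup>2 * u\<^sup>2)
        * real_iter_int (perp_coords m x (insert k S) ks) u"
    have union: "insert k (S \<union> (I - {k})) = S \<union> I" using k by auto
    have IH: "gen_erf A (proj_perp A ?m {k}) (I - {k}) (u *\<^sub>R x)
        = (\<Sum>ks\<in>distinct_lists (I - {k}). ?E (k # ks) * real_iter_int (perp_coords m x (insert k S) ks) u)"
      if "u \<ge> 0" for u
    proof -
      have sets: "insert k S \<union> set ks = S \<union> set (k # ks)" "I - {k} - set ks = I - set (k # ks)" for ks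
        by auto
      have "gen_erf A (proj_perp A m (insert k S)) (I - {k}) (u *\<^sub>R x)
        = (\<Sum>ks\<in>distinct_lists (I - {k}). gen_erf A (proj_perp A m (insert k S \<union> set ks))
            (I - {k} - set ks) 0 * real_iter_int (perp_coords m x (insert k S) ks) u)"
      proof (rule less.hyps)
        show "card (I - {k}) < card I" by (rule card_Diff1_less[OF fin(2) k])
      qed (use less.prems that in \<open>auto simp: union\<close>)
      then show ?thesis unfolding sets proj_perp_insert[OF fin(1)] .
    qed
    have "integral {0..s} (\<lambda>u. 2 * ?c * exp (- pi * ?c\<^sup>2 * u\<^sup>2)
        * gen_erf A (proj_perp A ?m {k}) (I - {k}) (u *\<^sub>R x))
      = integral {0..s} (\<lambda>u. \<Sum>ks\<in>distinct_lists (I - {k}). ?E (k # ks) * ?g ks u)"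
      by (rule Henstock_Kurzweil_Integration.integral_cong)
        (simp add: IH sum_distrib_left mult_ac)
    also have "\<dots> = (\<Sum>ks\<in>distinct_lists (I - {k}). integral {0..s} (\<lambda>u. ?E (k # ks) * ?g ks u))"
      by (intro Henstock_Kurzweil_Integration.integral_sum finite_distinct_lists
          integrable_on_mult_right iter_integrand_integrable) (use fin in auto)
    also have "\<dots> = (\<Sum>ks\<in>distinct_lists (I - {k}).
        ?E (k # ks) * real_iter_int (perp_coords m x S (k # ks)) s)"
      by simp
    finally show "integral {0..s} (\<lambda>u. 2 * ?c * exp (- pi * ?c\<^sup>2 * u\<^sup>2)
        * gen_erf A (proj_perp A ?m {k}) (I - {k}) (u *\<^sub>R x))
      = (\<Sum>ks\<in>distinct_lists (I - {k}). ?E (k # ks) * real_iter_int (perp_coords m x S (k # ks)) s)" .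
  qed
  also have "gen_erf A ?m I 0 = ?E [] * real_iter_int (perp_coords m x S []) s" by simp
  finally show ?case
    using sum_distinct_lists[OF fin(2), of "\<lambda>ks. ?E ks * real_iter_int (perp_coords m x S ks) s"]
    by simp
qed

text \<open>The accumulated coordinates are taken with respect to normalized successive projections, which are
the Gram--Schmidt vectors.\<close>
lemma perp_coords_gram_schmidt:
  assumes m: "lin_indep_family m {1..r}" and \<sigma>: "\<sigma> permutes {1..r}" and "1 \<le> a" "l \<le> r"
  shows "perp_coords m x (\<sigma> ` {1..<a}) (map \<sigma> [a..<Suc l])
    = map (\<lambda>j. B (gram_schmidt_B A (\<lambda>i. m (\<sigma> i)) j) x) [a..<Suc l]"
  using assms(3)
proof (induction "Suc l - a" arbitrary: a)
  case 0
  then show ?case by simp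
next
  case (Suc d)
  then have "a < Suc l" by simp
  have u: "lin_indep_family (\<lambda>i. m (\<sigma> i)) {1..r}"
    unfolding lin_indep_family_def
  proof
    fix i assume i: "i \<in> {1..r}"
    have "\<sigma> ` ({1..r} - {i}) = {1..r} - {\<sigma> i}"
      using permutes_image[OF \<sigma>] permutes_inj[OF \<sigma>] by (simp add: image_set_diff)
    then have "(\<lambda>i. m (\<sigma> i)) ` ({1..r} - {i}) = m ` ({1..r} - {\<sigma> i})"
      by (metis image_image)
    then show "m (\<sigma> i) \<notin> span ((\<lambda>i. m (\<sigma> i)) ` ({1..r} - {i}))"
      using m permutes_in_image[OF \<sigma>, of i] i by (simp add: lin_indep_family_def)
  qed
  have "coord (proj_perp A m (\<sigma> ` {1..<a})) x (\<sigma> a) = B (gram_schmidt_B A (\<lambda>i. m (\<sigma> i)) a) x"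
    using gram_schmidt_B_eq[OF u, of a] Suc.prems \<open>a < Suc l\<close> assms(4)
    by (simp add: coord_def proj_perp_reindex)
  moreover have "insert (\<sigma> a) (\<sigma> ` {1..<a}) = \<sigma> ` {1..<Suc a}"
    using Suc.prems by (simp add: atLeastLessThanSuc)
  ultimately show ?case
    using Suc.hyps(1)[of "Suc a"] Suc.hyps(2) Suc.prems \<open>a < Suc l\<close>
    by (simp add: upt_conv_Cons del: upt_Suc)
qed

end

theorem lemma2p10:
  fixes A :: "real^'n^'n" and r :: nat and m :: "nat \<Rightarrow> real^'n"
    and \<tau> :: complex and x :: "real^'n"
  assumes A_int: "\<forall>i j. A $ i $ j \<in> \<int>"
    and A_sym: "transpose A = A"
    and A_pos: "pos_def_matrix A"
    and tau: "Im \<tau> > 0"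
    and m_inj: "inj_on m {1..r}"
    and m_indep: "independent (m ` {1..r})"
  shows "((\<forall>j\<in>{1..r}. bform A (m j) x \<noteq> 0) \<longrightarrow>
           of_real (sgn_B A m {1..r} x) = R_fun A r m \<tau> x) \<and>
         of_real (\<Sum>S\<in>Pow {1..r}.
             gen_erf A m S 0 * of_bool (\<forall>j\<in>S. bform A (m j) x = 0) * sgn_B A m ({1..r} - S) x)
           = R_fun A r m \<tau> x"
proof -
  interpret pos_def_form A by standard (use A_sym A_pos in auto)
  define I where "I = {1..r}"
  define Z where "Z = {j\<in>I. B (m j) x = 0}"
  have fin: "finite I" by (simp add: I_def)
  have m: "lin_indep_family m {1..r}" by (rule lin_indep_familyI[OF m_inj m_indep])
  let ?E = "\<lambda>ks. gen_erf A (proj_perp A m (set ks)) (I - set ks) 0"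
  let ?J = "\<lambda>ks. real_iter_int (perp_coords m x {} ks)"

  \<comment> \<open>The iterated integrals over the whole half-line, as limits of the truncated ones.\<close>
  define L where "L ks = (SOME L. (?J ks \<longlongrightarrow> L) at_top)" for ks
  have L: "(?J ks \<longlongrightarrow> L ks) at_top" for ks
    unfolding L_def using real_iter_int_convergent by (rule someI_ex)

  \<comment> \<open>Both evaluations of the limit of the error function along the ray through \<open>x\<close>.\<close>
  have "((\<lambda>s. gen_erf A m I (s *\<^sub>R x)) \<longlongrightarrow> gen_erf A m Z 0 * sgn_B A m (I - Z) x) at_top"
    unfolding Z_def by (rule gen_erf_limit[OF fin])
  moreover have "((\<lambda>s. gen_erf A m I (s *\<^sub>R x)) \<longlongrightarrow> (\<Sum>ks\<in>distinct_lists I. ?E ks * L ks)) at_top"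
  proof (rule Lim_transform_eventually)
    show "((\<lambda>s. \<Sum>ks\<in>distinct_lists I. ?E ks * ?J ks s) \<longlongrightarrow> (\<Sum>ks\<in>distinct_lists I. ?E ks * L ks)) at_top"
      by (intro tendsto_intros L)
    have empty: "proj_perp A m {} = m" by (rule ext) simp
    show "\<forall>\<^sub>F s in at_top. (\<Sum>ks\<in>distinct_lists I. ?E ks * ?J ks s) = gen_erf A m I (s *\<^sub>R x)"
      using eventually_ge_at_top[of 0]
    proof eventually_elim
      case (elim s)
      then show ?case
        using gen_erf_expansion[of m "{}" I s x] m fin by (simp add: I_def empty)
    qed
  qed
  ultimately have lim: "gen_erf A m Z 0 * sgn_B A m (I - Z) x = (\<Sum>ks\<in>distinct_lists I. ?E ks * L ks)"
    by (rule tendsto_unique[rotated]) simp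

  have "R_fun A r m \<tau> x = (\<Sum>\<sigma> | \<sigma> permutes {1..r}. \<Sum>l = 0..r.
      (of_real (?E (map \<sigma> [1..<Suc l])) * of_real (L (map \<sigma> [1..<Suc l]))) / fact (r - l))"
    unfolding R_fun_def
  proof (intro sum.cong refl)
    fix \<sigma> l assume "\<sigma> \<in> {\<sigma>. \<sigma> permutes {1..r}}" "l \<in> {0..r}"
    then have \<sigma>: "\<sigma> permutes {1..r}" and l: "l \<le> r" by auto
    let ?ks = "map \<sigma> [1..<Suc l]"
    have set: "set ?ks = \<sigma> ` {1..l}" by (simp add: atLeastLessThanSuc_atLeastAtMost del: upt_Suc)
    have "{1..r} - {1..l} = {l+1..r}" by auto
    then have diff: "I - \<sigma> ` {1..l} = \<sigma> ` {l+1..r}"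
      unfolding I_def by (metis image_set_diff permutes_image[OF \<sigma>] permutes_inj[OF \<sigma>])
    have "iter_int \<tau> (map (\<lambda>j. bform A (gram_schmidt_B A (\<lambda>i. m (\<sigma> i)) j) x) [1..<Suc l]) = of_real (L ?ks)"
      using iter_int_eq_limit[OF L[of ?ks], of \<tau>] perp_coords_gram_schmidt[OF m \<sigma>, of 1 l x] l
      by (simp del: upt_Suc)
    then show "of_real (gen_erf A (proj_perp A m (\<sigma> ` {1..l})) (\<sigma> ` {l+1..r}) 0 / fact (r - l)) *
        iter_int \<tau> (map (\<lambda>j. bform A (gram_schmidt_B A (\<lambda>i. m (\<sigma> i)) j) x) [1..<Suc l])
      = of_real (?E ?ks) * of_real (L ?ks) / fact (r - l)"
      unfolding set diff by simp
  qed
  also have "\<dots> = (\<Sum>ks\<in>distinct_lists I. of_real (?E ks) * of_real (L ks))"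
    unfolding I_def by (rule sum_permutations_eq_distinct_lists)
  also have "\<dots> = of_real (gen_erf A m Z 0 * sgn_B A m (I - Z) x)"
    unfolding lim by simp
  finally have R: "R_fun A r m \<tau> x = of_real (gen_erf A m Z 0 * sgn_B A m (I - Z) x)" .

  have "sgn_B A m I x = gen_erf A m Z 0 * sgn_B A m (I - Z) x" if "\<forall>j\<in>I. bform A (m j) x \<noteq> 0"
  proof -
    have "Z = {}" using that by (auto simp: Z_def)
    then show ?thesis by (simp add: gen_erf_def)
  qed
  moreover have "(\<Sum>S\<in>Pow I. gen_erf A m S 0 * of_bool (\<forall>j\<in>S. bform A (m j) x = 0) * sgn_B A m (I - S) x)
      = gen_erf A m Z 0 * sgn_B A m (I - Z) x"
  proof -
    have "(\<Sum>S\<in>Pow I. gen_erf A m S 0 * of_bool (\<forall>j\<in>S. bform A (m j) x = 0) * sgn_B A m (I - S) x)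
        = (\<Sum>S\<in>{Z}. gen_erf A m S 0 * of_bool (\<forall>j\<in>S. bform A (m j) x = 0) * sgn_B A m (I - S) x)"
    \<comment> \<open>A set \<open>S\<close> contributes only if it lies in \<open>Z\<close> and its complement avoids \<open>Z\<close>, hence only \<open>S = Z\<close>.\<close>
    proof (rule sum.mono_neutral_right)
      show "\<forall>S\<in>Pow I - {Z}. gen_erf A m S 0 * of_bool (\<forall>j\<in>S. bform A (m j) x = 0) * sgn_B A m (I - S) x = 0"
      proof
        fix S assume S: "S \<in> Pow I - {Z}"
        show "gen_erf A m S 0 * of_bool (\<forall>j\<in>S. bform A (m j) x = 0) * sgn_B A m (I - S) x = 0"
        proof (cases "S \<subseteq> Z")
          case True
          then obtain j where "j \<in> Z - S" using S by blast
          then have "sgn_B A m (I - S) x = 0"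
            using fin unfolding sgn_B_def Z_def by (intro prod_zero bexI[of _ j]) auto
          then show ?thesis by simp
        next
          case False
          then show ?thesis using S by (auto simp: Z_def)
        qed
      qed
    qed (use fin in \<open>auto simp: Z_def\<close>)
    also have "\<dots> = gen_erf A m Z 0 * sgn_B A m (I - Z) x" by (simp add: Z_def)
    finally show ?thesis .
  qed
  ultimately show ?thesis unfolding R I_def by auto
qed

end
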